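(* Let $M$ and $N$ be groups acting on each other (by automorphisms), and let $\xi^M_N\colon M\flat N\to N$ and $\xi^N_M\colon N\flat M\to M$ be the corresponding internal actions in the category $\mathbf{Grp}$ of groups. Then $\xi^M_N$ and $\xi^N_M$ are compatible in the internal (semi-abelian) sense if and only if the two group actions are compatible in the classical sense, i.e. if and only if $${}^{({}^{m}n)}m'={}^{mnm^{-1}}m'\qquad\text{and}\qquad{}^{({}^{n}m)}n'={}^{nmn^{-1}}n'$$ for all $m,m'\in M$ and $n,n'\in N$.
   Context: Classical setting: ${}^mn$ denotes the action of $m\in M$ on $n\in N$ and ${}^nm$ the action of $n\in N$ on $m\in M$; $M$ and $N$ also act on themselves by conjugation. These actions induce actions of the free product $M+N$ on $M$ and on $N$ (a word acts by letting its letters act successively), and this is the meaning of ${}^{mnm^{-1}}m'$ and ${}^{nmn^{-1}}n'$. Internal notation, in the semi-abelian category $\mathbf{Grp}$: $+$ is the coproduct (free product, with $A+B$ and $B+A$ identified), $i_A\colon A\to A+B$ and $i_B\colon B\to A+B$ are the inclusions, $[f,g]\colon A+B\to C$ is the morphism induced by $f\colon A\to C$, $g\colon B\to C$. The functor $\flat$: $k_{A,B}\colon A\flat B\to A+B$ is the kernel of $[1_A,0]\colon A+B\to A$, i.e. the subgroup of $A+B$ generated by the elements $aba^{-1}$; for $f\colon A\to A'$, $g\colon B\to B'$, $f\flat g$ is the restriction of $f+g$ to kernels. For fixed $A$, $A\flat(-)$ is a monad with unit $\eta^A_B\colon B\to A\flat B$ determined by $k_{A,B}\circ\eta^A_B=i_B$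 and multiplication $\mu^A_B\colon A\flat(A\flat B)\to A\flat B$ determined by $k_{A,B}\circ\mu^A_B=[i_A,k_{A,B}]\circ k_{A,A\flat B}$. An internal action of $A$ on $X$ is a morphism $\xi\colon A\flat X\to X$ making $X$ an algebra for this monad; internal actions in $\mathbf{Grp}$ correspond bijectively to group actions by automorphisms via $\xi(axa^{-1})={}^ax$. The conjugation action is $\chi_A=[1_A,1_A]\circ k_{A,A}\colon A\flat A\to A$. Cosmash products: $h_{A,B}\colon A\diamond B\to A+B$ is the kernel of the canonical morphism $A+B\to A\times B$; it factors as $h_{A,B}=k_{A,B}\circ i_{A,B}$ with $i_{A,B}\colon A\diamond B\to A\flat B$. $h_{A,B,C}\colon A\diamond B\diamond C\to A+B+C$ is the kernel of the morphism $A+B+C\to(A+B)\times(A+C)\times(B+C)$ with components $[i_A,i_B,0]$, $[i_A,0,i_C]$, $[0,i_B,i_C]$. The morphism $j_{A,B,C}\colon A\diamond B\diamond C\to(A+B)\flat C$ is the unique one with $k_{A+B,C}\circ j_{A,B,C}=h_{A,B,C}$. The folding morphism $S^{N,M}_{1,2}\colon M\diamond N\diamond M\to N\diamond M$ is the unique one such that $h_{N,M}\circ S^{N,M}_{1,2}$ equals $h_{M,N,M}$ followed by the morphism $M+N+M\to M+N$ which folds the two copies of $M$ by the codiagonal and is the identity on $N$. Similarly $S^{M,N}_{1,2}\colon M\diamond N\diamond N\to M\diamond N$ is induced by folding the two copies of $N$. Internal compatibility: internal actions $\xi^M_N\colon M\flat N\to N$ and $\xi^N_M\colon N\flat M\to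 M$ are compatible if there exist internal actions $\xi^{M+N}_M\colon(M+N)\flat M\to M$ and $\xi^{M+N}_N\colon(M+N)\flat N\to N$ such that: (CA.0) $\xi^{M+N}_M\circ(i_N\flat 1_M)=\xi^N_M$, $\ \xi^{M+N}_M\circ(i_M\flat 1_M)=\chi_M$, $\ \xi^{M+N}_M\circ j_{M,N,M}=\xi^N_M\circ i_{N,M}\circ S^{N,M}_{1,2}$, and $\xi^{M+N}_N\circ(i_M\flat 1_N)=\xi^M_N$, $\ \xi^{M+N}_N\circ(i_N\flat 1_N)=\chi_N$, $\ \xi^{M+N}_N\circ j_{M,N,N}=\xi^M_N\circ i_{M,N}\circ S^{M,N}_{1,2}$; (CA.M) $\xi^{M+N}_M\circ\big((\xi^N_M+\xi^M_N)\flat 1_M\big)=\xi^{M+N}_M\circ\big([k_{N,M},k_{M,N}]\flat 1_M\big)$ as morphisms $((N\flat M)+(M\flat N))\flat M\to M$; (CA.N) $\xi^{M+N}_N\circ\big((\xi^N_M+\xi^M_N)\flat 1_N\big)=\xi^{M+N}_N\circ\big([k_{N,M},k_{M,N}]\flat 1_N\big)$ as morphisms $((N\flat M)+(M\flat N))\flat N\to N$. *)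

theory Defs
  imports "HOL-Algebra.Coset" "HOL-Algebra.Bij"
begin

section \<open>The coproduct (free product) of two groups\<close>

text \<open>
  \<open>A \<amalg> B\<close> is presented as words over the disjoint union of the carriers, modulo the least
  congruence that makes both letter inclusions homomorphisms.
\<close>

definition coprod_words ::
  "('a, 'c) monoid_scheme \<Rightarrow> ('b, 'd) monoid_scheme \<Rightarrow> ('a + 'b) list set" where
  "coprod_words A B = lists (carrier A <+> carrier B)"

inductive coprod_eq ::
  "('a, 'c) monoid_scheme \<Rightarrow> ('b, 'd) monoid_scheme \<Rightarrow> ('a + 'b) list \<Rightarrow> ('a + 'b) list \<Rightarrow> bool"
  for A B where
  refl: "w \<in> coprod_words A B \<Longrightarrow> coprod_eq A B w w"
| sym: "coprod_eq A B u v \<Longrightarrow> coprod_eq A B v u"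
| trans: "coprod_eq A B u v \<Longrightarrow> coprod_eq A B v w \<Longrightarrow> coprod_eq A B u w"
| app: "coprod_eq A B u u' \<Longrightarrow> coprod_eq A B v v' \<Longrightarrow> coprod_eq A B (u @ v) (u' @ v')"
| one_l: "coprod_eq A B [Inl \<one>\<^bsub>A\<^esub>] []"
| one_r: "coprod_eq A B [Inr \<one>\<^bsub>B\<^esub>] []"
| mult_l: "a \<in> carrier A \<Longrightarrow> a' \<in> carrier A
    \<Longrightarrow> coprod_eq A B [Inl a, Inl a'] [Inl (a \<otimes>\<^bsub>A\<^esub> a')]"
| mult_r: "b \<in> carrier B \<Longrightarrow> b' \<in> carrier B
    \<Longrightarrow> coprod_eq A B [Inr b, Inr b'] [Inr (b \<otimes>\<^bsub>B\<^esub> b')]"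

definition coprod_class ::
  "('a, 'c) monoid_scheme \<Rightarrow> ('b, 'd) monoid_scheme \<Rightarrow> ('a + 'b) list \<Rightarrow> ('a + 'b) list set" where
  "coprod_class A B w = {w'. coprod_eq A B w w'}"

definition coprod ::
  "('a, 'c) monoid_scheme \<Rightarrow> ('b, 'd) monoid_scheme \<Rightarrow> ('a + 'b) list set monoid"
  (infixl \<open>\<amalg>\<close> 65) where
  "A \<amalg> B =
    \<lparr>carrier = coprod_class A B ` coprod_words A B,
     mult = (\<lambda>X Y. {w. \<exists>u\<in>X. \<exists>v\<in>Y. coprod_eq A B (u @ v) w}),
     one = coprod_class A B []\<rparr>"

definition incl1 ::
  "('a, 'c) monoid_scheme \<Rightarrow> ('b, 'd) monoid_scheme \<Rightarrow> 'a \<Rightarrow> ('a + 'b) list set" where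
  "incl1 A B a = coprod_class A B [Inl a]"

definition incl2 ::
  "('a, 'c) monoid_scheme \<Rightarrow> ('b, 'd) monoid_scheme \<Rightarrow> 'b \<Rightarrow> ('a + 'b) list set" where
  "incl2 A B b = coprod_class A B [Inr b]"

fun word_eval ::
  "('g, 'e) monoid_scheme \<Rightarrow> ('a \<Rightarrow> 'g) \<Rightarrow> ('b \<Rightarrow> 'g) \<Rightarrow> ('a + 'b) list \<Rightarrow> 'g" where
  "word_eval G f g [] = \<one>\<^bsub>G\<^esub>"
| "word_eval G f g (Inl a # w) = f a \<otimes>\<^bsub>G\<^esub> word_eval G f g w"
| "word_eval G f g (Inr b # w) = g b \<otimes>\<^bsub>G\<^esub> word_eval G f g w"

text \<open>
  The induced morphism \<open>[f, g] : A \<amalg> B \<rightarrow> G\<close>. The value does not depend on the representative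
  (lemma \<open>copair_class\<close>).
\<close>

definition copair ::
  "('g, 'e) monoid_scheme \<Rightarrow> ('a \<Rightarrow> 'g) \<Rightarrow> ('b \<Rightarrow> 'g) \<Rightarrow> ('a + 'b) list set \<Rightarrow> 'g" where
  "copair G f g X = word_eval G f g (SOME w. w \<in> X)"

text \<open>\<open>f + g\<close> for \<open>f : A \<rightarrow> A'\<close> and \<open>g : B \<rightarrow> B'\<close>.\<close>

definition coprod_map ::
  "('a2, 'c) monoid_scheme \<Rightarrow> ('b2, 'd) monoid_scheme \<Rightarrow> ('a \<Rightarrow> 'a2) \<Rightarrow> ('b \<Rightarrow> 'b2)
    \<Rightarrow> ('a + 'b) list set \<Rightarrow> ('a2 + 'b2) list set" where
  "coprod_map A' B' f g = copair (A' \<amalg> B') (incl1 A' B' \<circ> f) (incl2 A' B' \<circ> g)"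

text \<open>The identification of \<open>A \<amalg> B\<close> with \<open>B \<amalg> A\<close>.\<close>

definition coprod_swap ::
  "('a, 'c) monoid_scheme \<Rightarrow> ('b, 'd) monoid_scheme
    \<Rightarrow> ('a + 'b) list set \<Rightarrow> ('b + 'a) list set" where
  "coprod_swap A B = copair (B \<amalg> A) (incl2 B A) (incl1 B A)"


subsection \<open>Universal property\<close>

lemma coprod_words_simps [simp]:
  "[] \<in> coprod_words A B"
  "Inl a # w \<in> coprod_words A B \<longleftrightarrow> a \<in> carrier A \<and> w \<in> coprod_words A B"
  "Inr b # w \<in> coprod_words A B \<longleftrightarrow> b \<in> carrier B \<and> w \<in> coprod_words A B"
  "u @ v \<in> coprod_words A B \<longleftrightarrow> u \<in> coprod_words A B \<and> v \<in> coprod_words A B"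
  by (auto simp: coprod_words_def)

lemma coprod_words_induct [consumes 1, case_names Nil Inl Inr]:
  assumes "w \<in> coprod_words A B" and "P []"
    and "\<And>a w. a \<in> carrier A \<Longrightarrow> w \<in> coprod_words A B \<Longrightarrow> P w \<Longrightarrow> P (Inl a # w)"
    and "\<And>b w. b \<in> carrier B \<Longrightarrow> w \<in> coprod_words A B \<Longrightarrow> P w \<Longrightarrow> P (Inr b # w)"
  shows "P w"
  using assms(1)
proof (induction w)
  case Nil
  show ?case by (fact assms(2))
next
  case (Cons x w)
  then show ?case by (cases x) (auto intro: assms(3,4))
qed

lemma coprod_eq_words:
  assumes "coprod_eq A B u v" "monoid A" "monoid B"
  shows "u \<in> coprod_words A B" "v \<in> coprod_words A B"
proof -
  interpret A: monoid A by fact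
  interpret B: monoid B by fact
  have "u \<in> coprod_words A B \<and> v \<in> coprod_words A B"
    using assms(1) by induction auto
  then show "u \<in> coprod_words A B" "v \<in> coprod_words A B" by auto
qed

lemma coprod_class_eq_iff:
  assumes "v \<in> coprod_words A B"
  shows "coprod_class A B u = coprod_class A B v \<longleftrightarrow> coprod_eq A B u v"
proof
  assume "coprod_class A B u = coprod_class A B v"
  moreover have "v \<in> coprod_class A B v"
    using assms by (simp add: coprod_class_def coprod_eq.refl)
  ultimately show "coprod_eq A B u v"
    by (auto simp: coprod_class_def)
next
  assume "coprod_eq A B u v"
  then show "coprod_class A B u = coprod_class A B v"
    by (auto simp: coprod_class_def intro: coprod_eq.sym coprod_eq.trans)
qed

lemma coprod_mult_class:
  assumes "u \<in> coprod_words A B" "v \<in> coprod_words A B"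
  shows "coprod_class A B u \<otimes>\<^bsub>A \<amalg> B\<^esub> coprod_class A B v = coprod_class A B (u @ v)"
  using assms
  by (auto simp: coprod_def coprod_class_def
      intro: coprod_eq.refl coprod_eq.app coprod_eq.sym coprod_eq.trans)

lemma coprod_carrierE:
  assumes "x \<in> carrier (A \<amalg> B)"
  obtains w where "w \<in> coprod_words A B" "x = coprod_class A B w"
  using assms by (auto simp: coprod_def)

lemma coprod_carrierI: "w \<in> coprod_words A B \<Longrightarrow> coprod_class A B w \<in> carrier (A \<amalg> B)"
  by (auto simp: coprod_def)

lemma coprod_one: "\<one>\<^bsub>A \<amalg> B\<^esub> = coprod_class A B []"
  by (simp add: coprod_def)

lemma coprod_left_inverse:
  assumes "group A" "group B" "w \<in> coprod_words A B"
  shows "\<exists>v \<in> coprod_words A B. coprod_eq A B (v @ w) []"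
  using assms(3)
proof (induction rule: coprod_words_induct)
  case Nil
  then show ?case by (auto intro!: bexI[of _ "[]"] coprod_eq.refl)
next
  case (Inl a w)
  interpret A: group A by fact
  from Inl obtain v where v: "v \<in> coprod_words A B" "coprod_eq A B (v @ w) []" by blast
  have "coprod_eq A B [Inl (inv\<^bsub>A\<^esub> a), Inl a] []"
    using coprod_eq.mult_l[of "inv\<^bsub>A\<^esub> a" A a B] Inl(1) coprod_eq.one_l
    by (auto intro: coprod_eq.trans)
  then have "coprod_eq A B (v @ ([Inl (inv\<^bsub>A\<^esub> a), Inl a] @ w)) (v @ ([] @ w))"
    using v Inl by (intro coprod_eq.app coprod_eq.refl)
  then have "coprod_eq A B ((v @ [Inl (inv\<^bsub>A\<^esub> a)]) @ Inl a # w) []"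
    using v(2) by (auto intro: coprod_eq.trans)
  then show ?case using v Inl by (intro bexI[of _ "v @ [Inl (inv\<^bsub>A\<^esub> a)]"]) auto
next
  case (Inr b w)
  interpret B: group B by fact
  from Inr obtain v where v: "v \<in> coprod_words A B" "coprod_eq A B (v @ w) []" by blast
  have "coprod_eq A B [Inr (inv\<^bsub>B\<^esub> b), Inr b] []"
    using coprod_eq.mult_r[of "inv\<^bsub>B\<^esub> b" B b A] Inr(1) coprod_eq.one_r
    by (auto intro: coprod_eq.trans)
  then have "coprod_eq A B (v @ ([Inr (inv\<^bsub>B\<^esub> b), Inr b] @ w)) (v @ ([] @ w))"
    using v Inr by (intro coprod_eq.app coprod_eq.refl)
  then have "coprod_eq A B ((v @ [Inr (inv\<^bsub>B\<^esub> b)]) @ Inr b # w) []"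
    using v(2) by (auto intro: coprod_eq.trans)
  then show ?case using v Inr by (intro bexI[of _ "v @ [Inr (inv\<^bsub>B\<^esub> b)]"]) auto
qed

theorem group_coprod:
  assumes "group A" "group B"
  shows "group (A \<amalg> B)"
proof (rule groupI)
  show "\<one>\<^bsub>A \<amalg> B\<^esub> \<in> carrier (A \<amalg> B)"
    by (simp add: coprod_one coprod_carrierI)
next
  fix x y assume "x \<in> carrier (A \<amalg> B)" "y \<in> carrier (A \<amalg> B)"
  then show "x \<otimes>\<^bsub>A \<amalg> B\<^esub> y \<in> carrier (A \<amalg> B)"
    by (auto elim!: coprod_carrierE simp: coprod_mult_class intro!: coprod_carrierI)
next
  fix x y z assume "x \<in> carrier (A \<amalg> B)" "y \<in> carrier (A \<amalg> B)" "z \<in> carrier (A \<amalg> B)"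
  then show "x \<otimes>\<^bsub>A \<amalg> B\<^esub> y \<otimes>\<^bsub>A \<amalg> B\<^esub> z = x \<otimes>\<^bsub>A \<amalg> B\<^esub> (y \<otimes>\<^bsub>A \<amalg> B\<^esub> z)"
    by (auto elim!: coprod_carrierE simp: coprod_mult_class)
next
  fix x assume "x \<in> carrier (A \<amalg> B)"
  then show "\<one>\<^bsub>A \<amalg> B\<^esub> \<otimes>\<^bsub>A \<amalg> B\<^esub> x = x"
    by (auto elim!: coprod_carrierE simp: coprod_mult_class coprod_one)
next
  fix x assume "x \<in> carrier (A \<amalg> B)"
  then obtain w where w: "w \<in> coprod_words A B" "x = coprod_class A B w"
    by (rule coprod_carrierE)
  from coprod_left_inverse[OF assms w(1)] obtain v
    where "v \<in> coprod_words A B" "coprod_eq A B (v @ w) []" by blast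
  then show "\<exists>y\<in>carrier (A \<amalg> B). y \<otimes>\<^bsub>A \<amalg> B\<^esub> x = \<one>\<^bsub>A \<amalg> B\<^esub>"
    using w by (intro bexI[of _ "coprod_class A B v"])
      (auto simp: coprod_mult_class coprod_one coprod_class_eq_iff intro: coprod_carrierI)
qed

lemma incl1_hom: "incl1 A B \<in> hom A (A \<amalg> B)"
  by (auto simp: hom_def incl1_def coprod_mult_class coprod_class_eq_iff
      intro!: coprod_carrierI coprod_eq.sym[OF coprod_eq.mult_l]
      coprod_class_eq_iff[THEN iffD2])

lemma incl2_hom: "incl2 A B \<in> hom B (A \<amalg> B)"
  by (auto simp: hom_def incl2_def coprod_mult_class coprod_class_eq_iff
      intro!: coprod_carrierI coprod_eq.sym[OF coprod_eq.mult_r]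
      coprod_class_eq_iff[THEN iffD2])

lemma word_eval_closed:
  assumes "group G" "f \<in> carrier A \<rightarrow> carrier G" "g \<in> carrier B \<rightarrow> carrier G"
    and "w \<in> coprod_words A B"
  shows "word_eval G f g w \<in> carrier G"
proof -
  interpret group G by fact
  show ?thesis using assms(4) by (induction rule: coprod_words_induct) (use assms in auto)
qed

lemma word_eval_append:
  assumes "group G" "f \<in> carrier A \<rightarrow> carrier G" "g \<in> carrier B \<rightarrow> carrier G"
    and "u \<in> coprod_words A B" "v \<in> coprod_words A B"
  shows "word_eval G f g (u @ v) = word_eval G f g u \<otimes>\<^bsub>G\<^esub> word_eval G f g v"
proof -
  interpret group G by fact
  show ?thesis using assms(4)
  proof (induction rule: coprod_words_induct)
    case Nil
    show ?case using word_eval_closed[OF assms(1-3,5)] by simp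
  next
    case (Inl a w)
    with word_eval_closed[OF assms(1-3,5)] word_eval_closed[OF assms(1-3) Inl(2)] assms(2)
    show ?case by (auto simp: m_assoc Pi_iff)
  next
    case (Inr b w)
    with word_eval_closed[OF assms(1-3,5)] word_eval_closed[OF assms(1-3) Inr(2)] assms(3)
    show ?case by (auto simp: m_assoc Pi_iff)
  qed
qed

lemma word_eval_cong:
  assumes "group A" "group B" "group G" "f \<in> hom A G" "g \<in> hom B G"
    and "coprod_eq A B u v"
  shows "word_eval G f g u = word_eval G f g v"
proof -
  interpret A: group A by fact
  interpret B: group B by fact
  interpret G: group G by fact
  have fc: "f \<in> carrier A \<rightarrow> carrier G" and gc: "g \<in> carrier B \<rightarrow> carrier G"
    using assms by (auto simp: hom_def)
  have f1: "f \<one>\<^bsub>A\<^esub> = \<one>\<^bsub>G\<^esub>" and g1: "g \<one>\<^bsub>B\<^esub> = \<one>\<^bsub>G\<^esub>"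
    using assms by (auto intro: hom_one)
  show ?thesis using assms(6)
  proof induction
    case (app u u' v v')
    note W = coprod_eq_words[OF app(1) A.is_monoid B.is_monoid]
      coprod_eq_words[OF app(2) A.is_monoid B.is_monoid]
    show ?case
      using app.IH by (simp add: word_eval_append[OF assms(3) fc gc] W)
  next
    case (mult_l a a')
    then show ?case using fc assms(4) by (auto simp: hom_mult Pi_iff)
  next
    case (mult_r b b')
    then show ?case using gc assms(5) by (auto simp: hom_mult Pi_iff)
  qed (use f1 g1 in auto)
qed

lemma copair_class:
  assumes "group A" "group B" "group G" "f \<in> hom A G" "g \<in> hom B G"
    and "w \<in> coprod_words A B"
  shows "copair G f g (coprod_class A B w) = word_eval G f g w"
proof -
  have "w \<in> coprod_class A B w"
    using assms by (simp add: coprod_class_def coprod_eq.refl)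
  then have "coprod_eq A B w (SOME w'. w' \<in> coprod_class A B w)"
    by (metis someI coprod_class_def mem_Collect_eq)
  then show ?thesis
    using word_eval_cong[OF assms(1-5)] by (simp add: copair_def)
qed

theorem copair_hom:
  assumes "group A" "group B" "group G" "f \<in> hom A G" "g \<in> hom B G"
  shows "copair G f g \<in> hom (A \<amalg> B) G"
proof -
  have fc: "f \<in> carrier A \<rightarrow> carrier G" and gc: "g \<in> carrier B \<rightarrow> carrier G"
    using assms by (auto simp: hom_def)
  show ?thesis
    by (auto simp: hom_def coprod_mult_class copair_class[OF assms]
        word_eval_closed[OF assms(3) fc gc] word_eval_append[OF assms(3) fc gc]
        elim!: coprod_carrierE)
qed

lemma copair_incl1:
  assumes "group A" "group B" "group G" "f \<in> hom A G" "g \<in> hom B G" "a \<in> carrier A"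
  shows "copair G f g (incl1 A B a) = f a"
proof -
  interpret group G by fact
  have "f a \<in> carrier G" using assms by (auto simp: hom_def)
  then show ?thesis using assms(6) by (simp add: incl1_def copair_class[OF assms(1-5)])
qed

lemma copair_incl2:
  assumes "group A" "group B" "group G" "f \<in> hom A G" "g \<in> hom B G" "b \<in> carrier B"
  shows "copair G f g (incl2 A B b) = g b"
proof -
  interpret group G by fact
  have "g b \<in> carrier G" using assms by (auto simp: hom_def)
  then show ?thesis using assms(6) by (simp add: incl2_def copair_class[OF assms(1-5)])
qed

theorem coprod_hom_eqI:
  assumes "group A" "group B" "group G"
    and h: "h \<in> hom (A \<amalg> B) G" "h' \<in> hom (A \<amalg> B) G"
    and 1: "\<And>a. a \<in> carrier A \<Longrightarrow> h (incl1 A B a) = h' (incl1 A B a)"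
    and 2: "\<And>b. b \<in> carrier B \<Longrightarrow> h (incl2 A B b) = h' (incl2 A B b)"
    and "x \<in> carrier (A \<amalg> B)"
  shows "h x = h' x"
proof -
  from assms(8) obtain w where w: "w \<in> coprod_words A B" "x = coprod_class A B w"
    by (rule coprod_carrierE)
  from w(1) have "h (coprod_class A B w) = h' (coprod_class A B w)"
  proof (induction rule: coprod_words_induct)
    case Nil
    show ?case
      using hom_one[OF h(1) group_coprod[OF assms(1,2)] assms(3)]
        hom_one[OF h(2) group_coprod[OF assms(1,2)] assms(3)]
      by (simp add: coprod_one)
  next
    case (Inl a w)
    have "coprod_class A B (Inl a # w) = incl1 A B a \<otimes>\<^bsub>A \<amalg> B\<^esub> coprod_class A B w"
      using Inl by (simp add: incl1_def coprod_mult_class)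
    then show ?case
      using Inl 1 hom_mult[OF h(1)] hom_mult[OF h(2)] incl1_hom[of A B]
      by (auto simp: coprod_carrierI hom_def Pi_iff)
  next
    case (Inr b w)
    have "coprod_class A B (Inr b # w) = incl2 A B b \<otimes>\<^bsub>A \<amalg> B\<^esub> coprod_class A B w"
      using Inr by (simp add: incl2_def coprod_mult_class)
    then show ?case
      using Inr 2 hom_mult[OF h(1)] hom_mult[OF h(2)] incl2_hom[of A B]
      by (auto simp: coprod_carrierI hom_def Pi_iff)
  qed
  with w show ?thesis by simp
qed


section \<open>Kernels: \<open>A \<flat> B\<close> and cosmash products\<close>

text \<open>
  Every kernel below is the actual subgroup of the ambient coproduct. Hence the monomorphisms
  \<open>k\<^bsub>A,B\<^esub> : A \<flat> B \<rightarrow> A \<amalg> B\<close>, \<open>h\<^bsub>A,B\<^esub> : A \<diamondop> B \<rightarrow> A \<amalg> B\<close>, \<open>i\<^bsub>A,B\<^esub> : A \<diamondop> B \<rightarrow> A \<flat> B\<close>,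
  \<open>h\<^bsub>A,B,C\<^esub> : A \<diamondop> B \<diamondop> C \<rightarrow> A \<amalg> B \<amalg> C\<close> and
  \<open>j\<^bsub>A,B,C\<^esub> : A \<diamondop> B \<diamondop> C \<rightarrow> (A \<amalg> B) \<flat> C\<close> are inclusions of subsets and leave no
  trace in formulas, and a morphism into a kernel determined by its composite with the kernel
  inclusion is that composite itself. In particular \<open>f \<flat> g\<close>, the restriction of \<open>f + g\<close>, is
  written \<open>coprod_map\<close>, applied to elements of \<open>A \<flat> B\<close>.
\<close>

definition flat ::
  "('a, 'c) monoid_scheme \<Rightarrow> ('b, 'd) monoid_scheme \<Rightarrow> ('a + 'b) list set monoid"
  (infix \<open>\<flat>\<close> 70) where
  "A \<flat> B = (A \<amalg> B)\<lparr>carrier := kernel (A \<amalg> B) A (copair A (\<lambda>a. a) (\<lambda>_. \<one>\<^bsub>A\<^esub>))\<rparr>"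

definition to_product2 ::
  "('a, 'c) monoid_scheme \<Rightarrow> ('b, 'd) monoid_scheme \<Rightarrow> ('a + 'b) list set \<Rightarrow> 'a \<times> 'b" where
  "to_product2 A B x = (copair A (\<lambda>a. a) (\<lambda>_. \<one>\<^bsub>A\<^esub>) x, copair B (\<lambda>_. \<one>\<^bsub>B\<^esub>) (\<lambda>b. b) x)"

definition cosmash2 ::
  "('a, 'c) monoid_scheme \<Rightarrow> ('b, 'd) monoid_scheme \<Rightarrow> ('a + 'b) list set monoid" where
  "cosmash2 A B = (A \<amalg> B)\<lparr>carrier := kernel (A \<amalg> B) (A \<times>\<times> B) (to_product2 A B)\<rparr>"

text \<open>The morphism \<open>A \<amalg> B \<amalg> C \<rightarrow> G\<close> with components \<open>f\<close>, \<open>g\<close>, \<open>h\<close>.\<close>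

definition cotriple ::
  "('g, 'e) monoid_scheme \<Rightarrow> ('a \<Rightarrow> 'g) \<Rightarrow> ('b \<Rightarrow> 'g) \<Rightarrow> ('c \<Rightarrow> 'g)
    \<Rightarrow> (('a + 'b) list set + 'c) list set \<Rightarrow> 'g" where
  "cotriple G f g h = copair G (copair G f g) h"

definition to_product3 ::
  "('a, 'd) monoid_scheme \<Rightarrow> ('b, 'e) monoid_scheme \<Rightarrow> ('c, 'f) monoid_scheme
    \<Rightarrow> (('a + 'b) list set + 'c) list set
    \<Rightarrow> ('a + 'b) list set \<times> ('a + 'c) list set \<times> ('b + 'c) list set" where
  "to_product3 A B C x =
    (cotriple (A \<amalg> B) (incl1 A B) (incl2 A B) (\<lambda>_. \<one>\<^bsub>A \<amalg> B\<^esub>) x,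
     cotriple (A \<amalg> C) (incl1 A C) (\<lambda>_. \<one>\<^bsub>A \<amalg> C\<^esub>) (incl2 A C) x,
     cotriple (B \<amalg> C) (\<lambda>_. \<one>\<^bsub>B \<amalg> C\<^esub>) (incl1 B C) (incl2 B C) x)"

definition cosmash3 ::
  "('a, 'd) monoid_scheme \<Rightarrow> ('b, 'e) monoid_scheme \<Rightarrow> ('c, 'f) monoid_scheme
    \<Rightarrow> (('a + 'b) list set + 'c) list set monoid" where
  "cosmash3 A B C = (A \<amalg> B \<amalg> C)
    \<lparr>carrier := kernel (A \<amalg> B \<amalg> C)
      ((A \<amalg> B) \<times>\<times> (A \<amalg> C) \<times>\<times> (B \<amalg> C)) (to_product3 A B C)\<rparr>"

text \<open>
  The folding morphisms \<open>S\<^bsub>1,2\<^esub> : M \<diamondop> N \<diamondop> M \<rightarrow> N \<diamondop> M\<close> and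
  \<open>S\<^bsub>1,2\<^esub> : M \<diamondop> N \<diamondop> N \<rightarrow> M \<diamondop> N\<close>.
\<close>

definition fold_outer ::
  "('n, 'd) monoid_scheme \<Rightarrow> ('m, 'c) monoid_scheme
    \<Rightarrow> (('m + 'n) list set + 'm) list set \<Rightarrow> ('n + 'm) list set" where
  "fold_outer N M = cotriple (N \<amalg> M) (incl2 N M) (incl1 N M) (incl2 N M)"

definition fold_right ::
  "('m, 'c) monoid_scheme \<Rightarrow> ('n, 'd) monoid_scheme
    \<Rightarrow> (('m + 'n) list set + 'n) list set \<Rightarrow> ('m + 'n) list set" where
  "fold_right M N = cotriple (M \<amalg> N) (incl1 M N) (incl2 M N) (incl2 M N)"


subsection \<open>The inclusions used implicitly\<close>

lemma zero_hom: "group G \<Longrightarrow> (\<lambda>_. \<one>\<^bsub>G\<^esub>) \<in> hom A G"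
  by (simp add: hom_def group.is_monoid monoid.l_one monoid.one_closed)

lemma id_hom: "(\<lambda>a. a) \<in> hom A A"
  by (simp add: hom_def)

lemma cotriple_hom:
  assumes "group A" "group B" "group C" "group G" "f \<in> hom A G" "g \<in> hom B G" "h \<in> hom C G"
  shows "cotriple G f g h \<in> hom (A \<amalg> B \<amalg> C) G"
  unfolding cotriple_def using assms by (intro copair_hom group_coprod)

lemma coprod3_hom_eqI:
  assumes "group A" "group B" "group C" "group G"
    and h: "h \<in> hom (A \<amalg> B \<amalg> C) G" "h' \<in> hom (A \<amalg> B \<amalg> C) G"
    and 1: "\<And>a. a \<in> carrier A \<Longrightarrow>
      h (incl1 (A \<amalg> B) C (incl1 A B a)) = h' (incl1 (A \<amalg> B) C (incl1 A B a))"
    and 2: "\<And>b. b \<in> carrier B \<Longrightarrow>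
      h (incl1 (A \<amalg> B) C (incl2 A B b)) = h' (incl1 (A \<amalg> B) C (incl2 A B b))"
    and 3: "\<And>c. c \<in> carrier C \<Longrightarrow> h (incl2 (A \<amalg> B) C c) = h' (incl2 (A \<amalg> B) C c)"
    and x: "x \<in> carrier (A \<amalg> B \<amalg> C)"
  shows "h x = h' x"
proof (rule coprod_hom_eqI[OF group_coprod[OF assms(1,2)] assms(3,4) h _ 3 x])
  fix y assume y: "y \<in> carrier (A \<amalg> B)"
  have "(h \<circ> incl1 (A \<amalg> B) C) y = (h' \<circ> incl1 (A \<amalg> B) C) y"
    by (rule coprod_hom_eqI[OF assms(1,2,4) hom_compose[OF incl1_hom h(1)]
          hom_compose[OF incl1_hom h(2)] _ _ y]) (simp_all add: 1 2)
  then show "h (incl1 (A \<amalg> B) C y) = h' (incl1 (A \<amalg> B) C y)" by simp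
qed

lemma cotriple_incl:
  assumes "group A" "group B" "group C" "group G" "f \<in> hom A G" "g \<in> hom B G" "h \<in> hom C G"
  shows "a \<in> carrier A \<Longrightarrow> cotriple G f g h (incl1 (A \<amalg> B) C (incl1 A B a)) = f a"
    and "b \<in> carrier B \<Longrightarrow> cotriple G f g h (incl1 (A \<amalg> B) C (incl2 A B b)) = g b"
    and "c \<in> carrier C \<Longrightarrow> cotriple G f g h (incl2 (A \<amalg> B) C c) = h c"
  by (simp_all add: cotriple_def hom_in_carrier[OF incl1_hom] hom_in_carrier[OF incl2_hom]
      copair_incl1[OF assms(1,2,4-6)] copair_incl2[OF assms(1,2,4-6)]
      copair_incl1[OF group_coprod[OF assms(1,2)] assms(3,4) copair_hom[OF assms(1,2,4-6)] assms(7)]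
      copair_incl2[OF group_coprod[OF assms(1,2)] assms(3,4) copair_hom[OF assms(1,2,4-6)] assms(7)])

lemma cosmash2_subset_flat: "carrier (cosmash2 A B) \<subseteq> carrier (A \<flat> B)"
  by (auto simp: cosmash2_def flat_def kernel_def to_product2_def)

lemma cosmash3_subset_flat:
  assumes "group A" "group B" "group C"
  shows "carrier (cosmash3 A B C) \<subseteq> carrier ((A \<amalg> B) \<flat> C)"
proof
  fix x assume x: "x \<in> carrier (cosmash3 A B C)"
  note AB = group_coprod[OF assms(1,2)]
  have xc: "x \<in> carrier (A \<amalg> B \<amalg> C)"
    using x by (simp add: cosmash3_def kernel_def)
  have "copair (A \<amalg> B) (\<lambda>y. y) (\<lambda>_. \<one>\<^bsub>A \<amalg> B\<^esub>) x
      = cotriple (A \<amalg> B) (incl1 A B) (incl2 A B) (\<lambda>_. \<one>\<^bsub>A \<amalg> B\<^esub>) x"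
  proof (rule coprod3_hom_eqI[OF assms AB _ _ _ _ _ xc])
    show "copair (A \<amalg> B) (\<lambda>y. y) (\<lambda>_. \<one>\<^bsub>A \<amalg> B\<^esub>) \<in> hom (A \<amalg> B \<amalg> C) (A \<amalg> B)"
      by (rule copair_hom[OF AB assms(3) AB id_hom zero_hom[OF AB]])
    show "cotriple (A \<amalg> B) (incl1 A B) (incl2 A B) (\<lambda>_. \<one>\<^bsub>A \<amalg> B\<^esub>) \<in> hom (A \<amalg> B \<amalg> C) (A \<amalg> B)"
      by (rule cotriple_hom[OF assms AB incl1_hom incl2_hom zero_hom[OF AB]])
  qed (simp_all add: cotriple_incl[OF assms AB incl1_hom incl2_hom zero_hom[OF AB]]
      copair_incl1[OF AB assms(3) AB id_hom zero_hom[OF AB]]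
      copair_incl2[OF AB assms(3) AB id_hom zero_hom[OF AB]]
      hom_in_carrier[OF incl1_hom] hom_in_carrier[OF incl2_hom])
  then show "x \<in> carrier ((A \<amalg> B) \<flat> C)"
    using x xc by (simp add: cosmash3_def flat_def kernel_def to_product3_def)
qed


lemma cotriple_comp:
  assumes "group A" "group B" "group C" "group G" "group K"
    and "f \<in> hom A G" "g \<in> hom B G" "h \<in> hom C G" "p \<in> hom G K"
    and "f' \<in> hom A K" "g' \<in> hom B K" "h' \<in> hom C K"
    and "\<And>a. a \<in> carrier A \<Longrightarrow> p (f a) = f' a"
    and "\<And>b. b \<in> carrier B \<Longrightarrow> p (g b) = g' b"
    and "\<And>c. c \<in> carrier C \<Longrightarrow> p (h c) = h' c"
    and "x \<in> carrier (A \<amalg> B \<amalg> C)"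
  shows "p (cotriple G f g h x) = cotriple K f' g' h' x"
proof -
  have "(p \<circ> cotriple G f g h) x = cotriple K f' g' h' x"
    by (rule coprod3_hom_eqI[OF assms(1-3,5)
          hom_compose[OF cotriple_hom[OF assms(1-4,6-8)] assms(9)]
          cotriple_hom[OF assms(1-3,5,10-12)] _ _ _ assms(16)])
      (simp_all add: cotriple_incl[OF assms(1-4,6-8)] cotriple_incl[OF assms(1-3,5,10-12)]
        assms(13-15))
  then show ?thesis by simp
qed

lemma fold_outer_cosmash:
  assumes "group M" "group N" "x \<in> carrier (cosmash3 M N M)"
  shows "fold_outer N M x \<in> carrier (cosmash2 N M)"
proof -
  note MN = group_coprod[OF assms(1,2)] and NM = group_coprod[OF assms(2,1)]
    and MM = group_coprod[OF assms(1,1)]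
  note z = zero_hom[OF assms(1)] zero_hom[OF assms(2)]
  note grps = assms(1,2) MN NM MM
  have xc: "x \<in> carrier (M \<amalg> N \<amalg> M)"
    and x1: "cotriple (M \<amalg> N) (incl1 M N) (incl2 M N) (\<lambda>_. \<one>\<^bsub>M \<amalg> N\<^esub>) x = \<one>\<^bsub>M \<amalg> N\<^esub>"
    and x2: "cotriple (M \<amalg> M) (incl1 M M) (\<lambda>_. \<one>\<^bsub>M \<amalg> M\<^esub>) (incl2 M M) x = \<one>\<^bsub>M \<amalg> M\<^esub>"
    using assms(3) by (simp_all add: cosmash3_def kernel_def to_product3_def)
  have "copair N (\<lambda>_. \<one>\<^bsub>N\<^esub>) (\<lambda>n. n)
      (cotriple (M \<amalg> N) (incl1 M N) (incl2 M N) (\<lambda>_. \<one>\<^bsub>M \<amalg> N\<^esub>) x)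
    = cotriple N (\<lambda>_. \<one>\<^bsub>N\<^esub>) (\<lambda>n. n) (\<lambda>_. \<one>\<^bsub>N\<^esub>) x"
    by (rule cotriple_comp[OF assms(1,2,1)]) (simp_all add: grps xc incl1_hom incl2_hom zero_hom id_hom copair_hom
        copair_incl1[OF assms(1,2,2) z(2) id_hom] copair_incl2[OF assms(1,2,2) z(2) id_hom]
        hom_one[OF copair_hom[OF assms(1,2,2) z(2) id_hom]])
  moreover have "copair N (\<lambda>n. n) (\<lambda>_. \<one>\<^bsub>N\<^esub>) (fold_outer N M x)
    = cotriple N (\<lambda>_. \<one>\<^bsub>N\<^esub>) (\<lambda>n. n) (\<lambda>_. \<one>\<^bsub>N\<^esub>) x"
    unfolding fold_outer_def
    by (rule cotriple_comp[OF assms(1,2,1)]) (simp_all add: grps xc incl1_hom incl2_hom zero_hom id_hom copair_hom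
        copair_incl1[OF assms(2,1,2) id_hom z(2)] copair_incl2[OF assms(2,1,2) id_hom z(2)])
  ultimately have 1: "copair N (\<lambda>n. n) (\<lambda>_. \<one>\<^bsub>N\<^esub>) (fold_outer N M x) = \<one>\<^bsub>N\<^esub>"
    using x1 hom_one[OF copair_hom[OF assms(1,2,2) z(2) id_hom] MN assms(2)] by simp
  have "copair M (\<lambda>m. m) (\<lambda>m. m)
      (cotriple (M \<amalg> M) (incl1 M M) (\<lambda>_. \<one>\<^bsub>M \<amalg> M\<^esub>) (incl2 M M) x)
    = cotriple M (\<lambda>m. m) (\<lambda>_. \<one>\<^bsub>M\<^esub>) (\<lambda>m. m) x"
    by (rule cotriple_comp[OF assms(1,2,1)]) (simp_all add: grps xc incl1_hom incl2_hom zero_hom id_hom copair_hom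
        copair_incl1[OF assms(1,1,1) id_hom id_hom] copair_incl2[OF assms(1,1,1) id_hom id_hom]
        hom_one[OF copair_hom[OF assms(1,1,1) id_hom id_hom]])
  moreover have "copair M (\<lambda>_. \<one>\<^bsub>M\<^esub>) (\<lambda>m. m) (fold_outer N M x)
    = cotriple M (\<lambda>m. m) (\<lambda>_. \<one>\<^bsub>M\<^esub>) (\<lambda>m. m) x"
    unfolding fold_outer_def
    by (rule cotriple_comp[OF assms(1,2,1)]) (simp_all add: grps xc incl1_hom incl2_hom zero_hom id_hom copair_hom
        copair_incl1[OF assms(2,1,1) z(1) id_hom] copair_incl2[OF assms(2,1,1) z(1) id_hom])
  ultimately have 2: "copair M (\<lambda>_. \<one>\<^bsub>M\<^esub>) (\<lambda>m. m) (fold_outer N M x) = \<one>\<^bsub>M\<^esub>"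
    using x2 hom_one[OF copair_hom[OF assms(1,1,1) id_hom id_hom] MM assms(1)] by simp
  have "fold_outer N M x \<in> carrier (N \<amalg> M)"
    unfolding fold_outer_def
    by (rule hom_in_carrier[OF cotriple_hom[OF assms(1,2,1) NM incl2_hom incl1_hom incl2_hom] xc])
  with 1 2 show ?thesis by (simp add: cosmash2_def kernel_def to_product2_def)
qed

lemma fold_right_cosmash:
  assumes "group M" "group N" "x \<in> carrier (cosmash3 M N N)"
  shows "fold_right M N x \<in> carrier (cosmash2 M N)"
proof -
  note MN = group_coprod[OF assms(1,2)] and NN = group_coprod[OF assms(2,2)]
  note z = zero_hom[OF assms(1)] zero_hom[OF assms(2)]
  note grps = assms(1,2) MN NN
  have xc: "x \<in> carrier (M \<amalg> N \<amalg> N)"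
    and x1: "cotriple (M \<amalg> N) (incl1 M N) (incl2 M N) (\<lambda>_. \<one>\<^bsub>M \<amalg> N\<^esub>) x = \<one>\<^bsub>M \<amalg> N\<^esub>"
    and x2: "cotriple (N \<amalg> N) (\<lambda>_. \<one>\<^bsub>N \<amalg> N\<^esub>) (incl1 N N) (incl2 N N) x = \<one>\<^bsub>N \<amalg> N\<^esub>"
    using assms(3) by (simp_all add: cosmash3_def kernel_def to_product3_def)
  have "copair M (\<lambda>m. m) (\<lambda>_. \<one>\<^bsub>M\<^esub>)
      (cotriple (M \<amalg> N) (incl1 M N) (incl2 M N) (\<lambda>_. \<one>\<^bsub>M \<amalg> N\<^esub>) x)
    = cotriple M (\<lambda>m. m) (\<lambda>_. \<one>\<^bsub>M\<^esub>) (\<lambda>_. \<one>\<^bsub>M\<^esub>) x"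
    by (rule cotriple_comp[OF assms(1,2,2)]) (simp_all add: grps xc incl1_hom incl2_hom zero_hom id_hom copair_hom
        copair_incl1[OF assms(1,2,1) id_hom z(1)] copair_incl2[OF assms(1,2,1) id_hom z(1)]
        hom_one[OF copair_hom[OF assms(1,2,1) id_hom z(1)]])
  moreover have "copair M (\<lambda>m. m) (\<lambda>_. \<one>\<^bsub>M\<^esub>) (fold_right M N x)
    = cotriple M (\<lambda>m. m) (\<lambda>_. \<one>\<^bsub>M\<^esub>) (\<lambda>_. \<one>\<^bsub>M\<^esub>) x"
    unfolding fold_right_def
    by (rule cotriple_comp[OF assms(1,2,2)]) (simp_all add: grps xc incl1_hom incl2_hom zero_hom id_hom copair_hom
        copair_incl1[OF assms(1,2,1) id_hom z(1)] copair_incl2[OF assms(1,2,1) id_hom z(1)])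
  ultimately have 1: "copair M (\<lambda>m. m) (\<lambda>_. \<one>\<^bsub>M\<^esub>) (fold_right M N x) = \<one>\<^bsub>M\<^esub>"
    using x1 hom_one[OF copair_hom[OF assms(1,2,1) id_hom z(1)] MN assms(1)] by simp
  have "copair N (\<lambda>n. n) (\<lambda>n. n)
      (cotriple (N \<amalg> N) (\<lambda>_. \<one>\<^bsub>N \<amalg> N\<^esub>) (incl1 N N) (incl2 N N) x)
    = cotriple N (\<lambda>_. \<one>\<^bsub>N\<^esub>) (\<lambda>n. n) (\<lambda>n. n) x"
    by (rule cotriple_comp[OF assms(1,2,2)]) (simp_all add: grps xc incl1_hom incl2_hom zero_hom id_hom copair_hom
        copair_incl1[OF assms(2,2,2) id_hom id_hom] copair_incl2[OF assms(2,2,2) id_hom id_hom]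
        hom_one[OF copair_hom[OF assms(2,2,2) id_hom id_hom]])
  moreover have "copair N (\<lambda>_. \<one>\<^bsub>N\<^esub>) (\<lambda>n. n) (fold_right M N x)
    = cotriple N (\<lambda>_. \<one>\<^bsub>N\<^esub>) (\<lambda>n. n) (\<lambda>n. n) x"
    unfolding fold_right_def
    by (rule cotriple_comp[OF assms(1,2,2)]) (simp_all add: grps xc incl1_hom incl2_hom zero_hom id_hom copair_hom
        copair_incl1[OF assms(1,2,2) z(2) id_hom] copair_incl2[OF assms(1,2,2) z(2) id_hom])
  ultimately have 2: "copair N (\<lambda>_. \<one>\<^bsub>N\<^esub>) (\<lambda>n. n) (fold_right M N x) = \<one>\<^bsub>N\<^esub>"
    using x2 hom_one[OF copair_hom[OF assms(2,2,2) id_hom id_hom] NN assms(2)] by simp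
  have "fold_right M N x \<in> carrier (M \<amalg> N)"
    unfolding fold_right_def
    by (rule hom_in_carrier[OF cotriple_hom[OF assms(1,2,2) MN incl1_hom incl2_hom incl2_hom] xc])
  with 1 2 show ?thesis by (simp add: cosmash2_def kernel_def to_product2_def)
qed


section \<open>Internal actions\<close>

text \<open>Algebras for the monad \<open>A \<flat> (-)\<close>, with unit \<open>flat_unit\<close> and multiplication \<open>flat_mult\<close>.\<close>

definition flat_unit ::
  "('a, 'c) monoid_scheme \<Rightarrow> ('x, 'd) monoid_scheme \<Rightarrow> 'x \<Rightarrow> ('a + 'x) list set" where
  "flat_unit A X = incl2 A X"

definition flat_mult ::
  "('a, 'c) monoid_scheme \<Rightarrow> ('x, 'd) monoid_scheme
    \<Rightarrow> ('a + ('a + 'x) list set) list set \<Rightarrow> ('a + 'x) list set" where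
  "flat_mult A X = copair (A \<amalg> X) (incl1 A X) (\<lambda>y. y)"

definition internal_action ::
  "('a, 'c) monoid_scheme \<Rightarrow> ('x, 'd) monoid_scheme \<Rightarrow> (('a + 'x) list set \<Rightarrow> 'x) \<Rightarrow> bool" where
  "internal_action A X \<xi> \<longleftrightarrow>
    \<xi> \<in> hom (A \<flat> X) X \<and>
    (\<forall>x \<in> carrier X. \<xi> (flat_unit A X x) = x) \<and>
    (\<forall>z \<in> carrier (A \<flat> (A \<flat> X)). \<xi> (flat_mult A X z) = \<xi> (coprod_map A X (\<lambda>a. a) \<xi> z))"

text \<open>
  The bijection between internal actions and group actions by automorphisms:
  \<open>\<xi> (a x a\<inverse>)\<close> is \<open>a\<close> acting on \<open>x\<close>.
\<close>

definition internal_action_of ::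
  "('a, 'c) monoid_scheme \<Rightarrow> ('x, 'd) monoid_scheme \<Rightarrow> ('a \<Rightarrow> 'x \<Rightarrow> 'x)
    \<Rightarrow> (('a + 'x) list set \<Rightarrow> 'x) \<Rightarrow> bool" where
  "internal_action_of A X \<alpha> \<xi> \<longleftrightarrow>
    internal_action A X \<xi> \<and>
    (\<forall>a \<in> carrier A. \<forall>x \<in> carrier X.
      \<xi> (incl1 A X a \<otimes>\<^bsub>A \<amalg> X\<^esub> incl2 A X x \<otimes>\<^bsub>A \<amalg> X\<^esub> incl1 A X (inv\<^bsub>A\<^esub> a)) = \<alpha> a x)"

definition conj_action :: "('a, 'c) monoid_scheme \<Rightarrow> ('a + 'a) list set \<Rightarrow> 'a" where
  "conj_action A = copair A (\<lambda>a. a) (\<lambda>a. a)"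


section \<open>Compatibility\<close>

text \<open>
  The conjuncts are the two triples of equations (CA.0) and then (CA.M), (CA.N); \<open>\<zeta>M\<close> and \<open>\<zeta>N\<close>
  are the actions of \<open>M \<amalg> N\<close> on \<open>M\<close> and \<open>N\<close>.
\<close>

definition internally_compatible ::
  "('m, 'c) monoid_scheme \<Rightarrow> ('n, 'd) monoid_scheme
    \<Rightarrow> (('m + 'n) list set \<Rightarrow> 'n) \<Rightarrow> (('n + 'm) list set \<Rightarrow> 'm) \<Rightarrow> bool" where
  "internally_compatible M N \<xi>MN \<xi>NM \<longleftrightarrow>
    (\<exists>\<zeta>M \<zeta>N.
      internal_action (M \<amalg> N) M \<zeta>M \<and>
      internal_action (M \<amalg> N) N \<zeta>N \<and>
      (\<forall>x \<in> carrier (N \<flat> M). \<zeta>M (coprod_map (M \<amalg> N) M (incl2 M N) (\<lambda>m. m) x) = \<xi>NM x) \<and>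
      (\<forall>x \<in> carrier (M \<flat> M). \<zeta>M (coprod_map (M \<amalg> N) M (incl1 M N) (\<lambda>m. m) x) = conj_action M x) \<and>
      (\<forall>x \<in> carrier (cosmash3 M N M). \<zeta>M x = \<xi>NM (fold_outer N M x)) \<and>
      (\<forall>x \<in> carrier (M \<flat> N). \<zeta>N (coprod_map (M \<amalg> N) N (incl1 M N) (\<lambda>n. n) x) = \<xi>MN x) \<and>
      (\<forall>x \<in> carrier (N \<flat> N). \<zeta>N (coprod_map (M \<amalg> N) N (incl2 M N) (\<lambda>n. n) x) = conj_action N x) \<and>
      (\<forall>x \<in> carrier (cosmash3 M N N). \<zeta>N x = \<xi>MN (fold_right M N x)) \<and>
      (\<forall>x \<in> carrier (((N \<flat> M) \<amalg> (M \<flat> N)) \<flat> M).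
        \<zeta>M (coprod_map (M \<amalg> N) M (coprod_map M N \<xi>NM \<xi>MN) (\<lambda>m. m) x) =
        \<zeta>M (coprod_map (M \<amalg> N) M (copair (M \<amalg> N) (coprod_swap N M) (\<lambda>y. y)) (\<lambda>m. m) x)) \<and>
      (\<forall>x \<in> carrier (((N \<flat> M) \<amalg> (M \<flat> N)) \<flat> N).
        \<zeta>N (coprod_map (M \<amalg> N) N (coprod_map M N \<xi>NM \<xi>MN) (\<lambda>n. n) x) =
        \<zeta>N (coprod_map (M \<amalg> N) N (copair (M \<amalg> N) (coprod_swap N M) (\<lambda>y. y)) (\<lambda>n. n) x)))"

text \<open>An action of \<open>A\<close> on \<open>X\<close> by automorphisms is an element of \<open>hom A (AutoGroup X)\<close>.\<close>

definition conjugation :: "('a, 'c) monoid_scheme \<Rightarrow> 'a \<Rightarrow> 'a \<Rightarrow> 'a" where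
  "conjugation A a = (\<lambda>x \<in> carrier A. a \<otimes>\<^bsub>A\<^esub> x \<otimes>\<^bsub>A\<^esub> inv\<^bsub>A\<^esub> a)"

text \<open>
  Here \<open>\<alpha>\<close> is the action of \<open>M\<close> on \<open>N\<close> and \<open>\<beta>\<close> that of \<open>N\<close> on \<open>M\<close>; the two \<open>copair\<close>s are the
  induced actions of \<open>M \<amalg> N\<close> on \<open>M\<close> and on \<open>N\<close>.
\<close>

definition classically_compatible ::
  "('m, 'c) monoid_scheme \<Rightarrow> ('n, 'd) monoid_scheme
    \<Rightarrow> ('m \<Rightarrow> 'n \<Rightarrow> 'n) \<Rightarrow> ('n \<Rightarrow> 'm \<Rightarrow> 'm) \<Rightarrow> bool" where
  "classically_compatible M N \<alpha> \<beta> \<longleftrightarrow>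
    (\<forall>m \<in> carrier M. \<forall>m' \<in> carrier M. \<forall>n \<in> carrier N.
      \<beta> (\<alpha> m n) m' =
      copair (AutoGroup M) (conjugation M) \<beta>
        (incl1 M N m \<otimes>\<^bsub>M \<amalg> N\<^esub> incl2 M N n \<otimes>\<^bsub>M \<amalg> N\<^esub> incl1 M N (inv\<^bsub>M\<^esub> m)) m') \<and>
    (\<forall>m \<in> carrier M. \<forall>n \<in> carrier N. \<forall>n' \<in> carrier N.
      \<alpha> (\<beta> n m) n' =
      copair (AutoGroup N) \<alpha> (conjugation N)
        (incl2 M N n \<otimes>\<^bsub>M \<amalg> N\<^esub> incl1 M N m \<otimes>\<^bsub>M \<amalg> N\<^esub> incl2 M N (inv\<^bsub>N\<^esub> n)) n')"

end

theory Submission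
  imports Defs
begin

text \<open>
  The group \<open>A \<flat> X\<close> is generated by the elements \<open>a x a\<inverse>\<close>, so equations between morphisms out of it
  need only be checked there; the semidirect product \<open>X \<rtimes> A\<close> provides, for each group action, a
  morphism \<open>A \<flat> X \<rightarrow> X\<close> with the prescribed values on these generators. Hence internal actions are
  the same as group actions. The first two equations of each triple in (CA.0) force the actions of
  \<open>M \<amalg> N\<close> on \<open>M\<close> and \<open>N\<close> to be the induced ones, and these satisfy the third equation
  automatically. Finally (CA.M) says that two morphisms \<open>(N \<flat> M) \<amalg> (M \<flat> N) \<rightarrow> M \<amalg> N \<rightarrow> Aut M\<close>
  agree: on the generators \<open>n m n\<inverse>\<close> they do because \<open>n\<close> acts by an automorphism, and on the
  generators \<open>m n m\<inverse>\<close> this is the first classical condition. (CA.N) is symmetric.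
\<close>

section \<open>Coproducts and the generators of \<open>A \<flat> X\<close>\<close>

lemma incl1_closed: "a \<in> carrier A \<Longrightarrow> incl1 A X a \<in> carrier (A \<amalg> X)"
  by (rule hom_in_carrier[OF incl1_hom])

lemma incl2_closed: "x \<in> carrier X \<Longrightarrow> incl2 A X x \<in> carrier (A \<amalg> X)"
  by (rule hom_in_carrier[OF incl2_hom])

lemma hom_inv_eq:
  assumes "group G" "group H" "h \<in> hom G H" "x \<in> carrier G"
  shows "h (inv\<^bsub>G\<^esub> x) = inv\<^bsub>H\<^esub> (h x)"
  using assms by (intro group_hom.hom_inv) (auto simp: group_hom_def group_hom_axioms_def)

text \<open>Stripping the first letter of a representing word gives an induction that no longer
  mentions words or their congruence.\<close>

lemma coprod_induct [consumes 1, case_names one incl1 incl2]: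
  assumes "z \<in> carrier (A \<amalg> X)" and "P \<one>\<^bsub>A \<amalg> X\<^esub>"
    and "\<And>a z. a \<in> carrier A \<Longrightarrow> z \<in> carrier (A \<amalg> X) \<Longrightarrow> P z \<Longrightarrow> P (incl1 A X a \<otimes>\<^bsub>A \<amalg> X\<^esub> z)"
    and "\<And>x z. x \<in> carrier X \<Longrightarrow> z \<in> carrier (A \<amalg> X) \<Longrightarrow> P z \<Longrightarrow> P (incl2 A X x \<otimes>\<^bsub>A \<amalg> X\<^esub> z)"
  shows "P z"
proof -
  obtain w where w: "w \<in> coprod_words A X" "z = coprod_class A X w"
    using assms(1) by (rule coprod_carrierE)
  from w(1) have "P (coprod_class A X w)"
  proof (induction rule: coprod_words_induct)
    case Nil
    then show ?case using assms(2) by (simp add: coprod_one)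
  next
    case (Inl a w)
    then show ?case
      using assms(3)[of a "coprod_class A X w"]
      by (simp add: incl1_def coprod_mult_class coprod_carrierI)
  next
    case (Inr x w)
    then show ?case
      using assms(4)[of x "coprod_class A X w"]
      by (simp add: incl2_def coprod_mult_class coprod_carrierI)
  qed
  then show ?thesis using w by simp
qed

section \<open>The kernel \<open>A \<flat> X\<close> as a subgroup of the coproduct\<close>

abbreviation flat_proj where
  "flat_proj A \<equiv> copair A (\<lambda>a. a) (\<lambda>_. \<one>\<^bsub>A\<^esub>)"

lemma flat_proj_hom: "group A \<Longrightarrow> group X \<Longrightarrow> flat_proj A \<in> hom (A \<amalg> X) A"
  by (intro copair_hom id_hom zero_hom)

lemma flat_proj_incl:
  assumes "group A" "group X"
  shows "a \<in> carrier A \<Longrightarrow> flat_proj A (incl1 A X a) = a"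
    and "x \<in> carrier X \<Longrightarrow> flat_proj A (incl2 A X x) = \<one>\<^bsub>A\<^esub>"
  using copair_incl1[OF assms assms(1) id_hom zero_hom[OF assms(1)]]
    copair_incl2[OF assms assms(1) id_hom zero_hom[OF assms(1)]] by auto

lemma flat_carrier_iff:
  "z \<in> carrier (A \<flat> X) \<longleftrightarrow> z \<in> carrier (A \<amalg> X) \<and> flat_proj A z = \<one>\<^bsub>A\<^esub>"
  by (simp add: flat_def kernel_def)

lemma flat_simps [simp]:
  "mult (A \<flat> X) = mult (A \<amalg> X)" "one (A \<flat> X) = one (A \<amalg> X)"
  by (simp_all add: flat_def)

lemma flat_subgroup:
  assumes "group A" "group X"
  shows "subgroup (carrier (A \<flat> X)) (A \<amalg> X)"
proof -
  interpret group_hom "A \<amalg> X" A "flat_proj A"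
    using assms flat_proj_hom[OF assms] group_coprod[OF assms]
    by (simp add: group_hom_def group_hom_axioms_def)
  show ?thesis using subgroup_kernel by (simp add: flat_def)
qed

lemma flat_eq: "A \<flat> X = (A \<amalg> X)\<lparr>carrier := carrier (A \<flat> X)\<rparr>"
  by (simp add: flat_def)

lemma group_flat: "group A \<Longrightarrow> group X \<Longrightarrow> group (A \<flat> X)"
  by (metis flat_eq flat_subgroup group_coprod subgroup.subgroup_is_group)

lemma flat_closed: "z \<in> carrier (A \<flat> X) \<Longrightarrow> z \<in> carrier (A \<amalg> X)"
  by (simp add: flat_carrier_iff)

text \<open>The conjugated element \<open>z\<close> is arbitrary, since the algebra law for
  \<open>A \<flat> (-)\<close> conjugates whole elements of \<open>A \<flat> X\<close> and not only
  letters of \<open>X\<close>. The last factor is the letter of the inverse, as in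
  \<open>internal_action_of\<close>; \<open>incl1_inv\<close> turns it into an inverse in the
  coproduct.\<close>

definition coprod_conj where
  "coprod_conj A X a z = incl1 A X a \<otimes>\<^bsub>A \<amalg> X\<^esub> z \<otimes>\<^bsub>A \<amalg> X\<^esub> incl1 A X (inv\<^bsub>A\<^esub> a)"

abbreviation flat_gen where
  "flat_gen A X a x \<equiv> coprod_conj A X a (incl2 A X x)"

lemma incl1_inv:
  "group A \<Longrightarrow> group X \<Longrightarrow> a \<in> carrier A \<Longrightarrow> incl1 A X (inv\<^bsub>A\<^esub> a) = inv\<^bsub>A \<amalg> X\<^esub> incl1 A X a"
  by (intro hom_inv_eq group_coprod incl1_hom)

lemma incl1_one: "group A \<Longrightarrow> group X \<Longrightarrow> incl1 A X \<one>\<^bsub>A\<^esub> = \<one>\<^bsub>A \<amalg> X\<^esub>"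
  by (intro hom_one incl1_hom group_coprod)

lemma coprod_conj_closed:
  assumes "group A" "group X" "a \<in> carrier A" "z \<in> carrier (A \<amalg> X)"
  shows "coprod_conj A X a z \<in> carrier (A \<amalg> X)"
proof -
  interpret A: group A by fact
  interpret C: group "A \<amalg> X" using assms by (intro group_coprod)
  show ?thesis using assms by (simp add: coprod_conj_def incl1_closed)
qed

lemma coprod_conj_mult:
  assumes "group A" "group X" "a \<in> carrier A" "b \<in> carrier A" "z \<in> carrier (A \<amalg> X)"
  shows "coprod_conj A X (a \<otimes>\<^bsub>A\<^esub> b) z = coprod_conj A X a (coprod_conj A X b z)"
proof -
  interpret A: group A by fact
  interpret C: group "A \<amalg> X" using assms by (intro group_coprod)
  show ?thesis
    using assms
    by (simp add: coprod_conj_def incl1_closed A.inv_mult_group C.m_assoc hom_mult[OF incl1_hom])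
qed

lemma coprod_conj_one:
  assumes "group A" "group X" "z \<in> carrier (A \<amalg> X)"
  shows "coprod_conj A X \<one>\<^bsub>A\<^esub> z = z"
proof -
  interpret A: group A by fact
  interpret C: group "A \<amalg> X" using assms by (intro group_coprod)
  show ?thesis
    using assms by (simp add: coprod_conj_def incl1_one)
qed

lemma coprod_conj_distrib:
  assumes "group A" "group X" "a \<in> carrier A" "y \<in> carrier (A \<amalg> X)" "z \<in> carrier (A \<amalg> X)"
  shows "coprod_conj A X a (y \<otimes>\<^bsub>A \<amalg> X\<^esub> z) = coprod_conj A X a y \<otimes>\<^bsub>A \<amalg> X\<^esub> coprod_conj A X a z"
proof -
  interpret A: group A by fact
  interpret C: group "A \<amalg> X" using assms by (intro group_coprod)
  have "inv\<^bsub>A \<amalg> X\<^esub> i \<otimes>\<^bsub>A \<amalg> X\<^esub> (i \<otimes>\<^bsub>A \<amalg> X\<^esub> w) = w"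
    if "i \<in> carrier (A \<amalg> X)" "w \<in> carrier (A \<amalg> X)" for i w
    using that by (simp flip: C.m_assoc)
  then show ?thesis
    using assms by (simp add: coprod_conj_def incl1_closed incl1_inv C.m_assoc)
qed

lemma hom_coprod_conj:
  assumes "group A" "group X" "group G" "h \<in> hom (A \<amalg> X) G" "a \<in> carrier A" "z \<in> carrier (A \<amalg> X)"
  shows "h (coprod_conj A X a z) = h (incl1 A X a) \<otimes>\<^bsub>G\<^esub> h z \<otimes>\<^bsub>G\<^esub> inv\<^bsub>G\<^esub> (h (incl1 A X a))"
proof -
  interpret A: group A by fact
  interpret C: group "A \<amalg> X" using assms by (intro group_coprod)
  show ?thesis
    using assms
    by (simp add: coprod_conj_def incl1_closed hom_mult[OF assms(4)] hom_inv_eq[OF C.is_group assms(3,4)] incl1_inv)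
qed

lemma coprod_conj_flat:
  assumes "group A" "group X" "a \<in> carrier A" "z \<in> carrier (A \<flat> X)"
  shows "coprod_conj A X a z \<in> carrier (A \<flat> X)"
proof -
  interpret A: group A by fact
  show ?thesis
    using assms
    by (simp add: flat_carrier_iff coprod_conj_closed hom_coprod_conj[OF assms(1,2,1) flat_proj_hom] flat_proj_incl)
qed

lemma incl2_flat: "group A \<Longrightarrow> group X \<Longrightarrow> x \<in> carrier X \<Longrightarrow> incl2 A X x \<in> carrier (A \<flat> X)"
  by (simp add: flat_carrier_iff incl2_closed flat_proj_incl)

lemma flat_gen_flat:
  "group A \<Longrightarrow> group X \<Longrightarrow> a \<in> carrier A \<Longrightarrow> x \<in> carrier X \<Longrightarrow> flat_gen A X a x \<in> carrier (A \<flat> X)"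
  by (intro coprod_conj_flat incl2_flat)

text \<open>For \<open>z\<close> in \<open>A \<amalg> X\<close> with image \<open>p z\<close> in \<open>A\<close>, one rewrites \<open>a z (p z)\<inverse> a\<inverse>\<close> as a product of
  generators by moving the letters of \<open>z\<close> one at a time; the case \<open>a = 1\<close>, \<open>p z = 1\<close> is the claim.\<close>

lemma flat_induct [consumes 3, case_names one gen]:
  assumes "group A" "group X" "z \<in> carrier (A \<flat> X)" and "P \<one>\<^bsub>A \<amalg> X\<^esub>"
    and gen: "\<And>a x z. a \<in> carrier A \<Longrightarrow> x \<in> carrier X \<Longrightarrow> z \<in> carrier (A \<flat> X) \<Longrightarrow> P z
      \<Longrightarrow> P (flat_gen A X a x \<otimes>\<^bsub>A \<amalg> X\<^esub> z)"
  shows "P z"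
proof -
  interpret A: group A by fact
  interpret X: group X by fact
  interpret C: group "A \<amalg> X" using assms by (intro group_coprod)
  \<comment> \<open>\<open>n z\<close> is the kernel part of \<open>z\<close>: \<open>z\<close> is
    the product of \<open>n z\<close> and the letter \<open>p z\<close>.\<close>
  define n where "n z = z \<otimes>\<^bsub>A \<amalg> X\<^esub> incl1 A X (inv\<^bsub>A\<^esub> (flat_proj A z))" for z
  note p = flat_proj_hom[OF assms(1,2)]
  note pc = hom_in_carrier[OF p]
  have n_flat: "n z \<in> carrier (A \<flat> X)" if "z \<in> carrier (A \<amalg> X)" for z
    using that by (simp add: n_def flat_carrier_iff incl1_closed pc hom_mult[OF p] flat_proj_incl)
  \<comment> \<open>The statement is made for all \<open>a\<close> because a leading letter
    \<open>b\<close> of \<open>A\<close> is absorbed into the conjugator, which changes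
    \<open>a\<close> into \<open>a b\<close>. A leading letter \<open>x\<close> of \<open>X\<close>
    instead splits off the generator \<open>a x a^-1\<close>.\<close>
  have "\<forall>a\<in>carrier A. P (coprod_conj A X a (n z))" if "z \<in> carrier (A \<amalg> X)" for z
    using that
  proof (induction rule: coprod_induct)
    case one
    then show ?case
      using assms(4)
      by (simp add: n_def coprod_conj_def hom_one[OF p] incl1_one incl1_inv incl1_closed)
  next
    case (incl1 b z)
    have "coprod_conj A X a (n (incl1 A X b \<otimes>\<^bsub>A \<amalg> X\<^esub> z)) = coprod_conj A X (a \<otimes>\<^bsub>A\<^esub> b) (n z)"
      if "a \<in> carrier A" for a
      using incl1(1,2) that
      by (simp add: n_def coprod_conj_def incl1_closed pc hom_mult[OF p] flat_proj_incl
          A.inv_mult_group C.m_assoc hom_mult[OF incl1_hom])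
    then show ?case using incl1 by auto
  next
    case (incl2 x z)
    have "coprod_conj A X a (n (incl2 A X x \<otimes>\<^bsub>A \<amalg> X\<^esub> z))
        = flat_gen A X a x \<otimes>\<^bsub>A \<amalg> X\<^esub> coprod_conj A X a (n z)"
      if "a \<in> carrier A" for a
    proof -
      have "n (incl2 A X x \<otimes>\<^bsub>A \<amalg> X\<^esub> z) = incl2 A X x \<otimes>\<^bsub>A \<amalg> X\<^esub> n z"
        using incl2(1,2)
        by (simp add: n_def incl1_closed incl2_closed pc hom_mult[OF p] flat_proj_incl C.m_assoc)
      then show ?thesis
        using that incl2(1,2) n_flat[OF incl2(2)]
        by (simp add: coprod_conj_distrib incl2_closed flat_closed)
    qed
    then show ?case
      using incl2 n_flat by (auto intro!: gen coprod_conj_flat)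
  qed
  from this[of z] have "P (coprod_conj A X \<one>\<^bsub>A\<^esub> (n z))"
    using assms(3) by (auto simp: flat_carrier_iff)
  moreover have "n z = z"
    using assms(3) by (simp add: n_def flat_carrier_iff incl1_one)
  ultimately show ?thesis
    using assms(3) by (simp add: coprod_conj_one flat_closed)
qed

text \<open>The induction multiplies by generators only. It reaches everything because the inverse
  of \<open>a x a^-1\<close> is the generator \<open>a x^-1 a^-1\<close>.\<close>

lemma flat_hom_eqI:
  assumes "group A" "group X" "group G"
    and h: "h \<in> hom (A \<flat> X) G" "h' \<in> hom (A \<flat> X) G"
    and eq: "\<And>a x. a \<in> carrier A \<Longrightarrow> x \<in> carrier X \<Longrightarrow> h (flat_gen A X a x) = h' (flat_gen A X a x)"
    and "z \<in> carrier (A \<flat> X)"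
  shows "h z = h' z"
  using assms(1,2,7)
proof (induction rule: flat_induct)
  case one
  show ?case
    using hom_one[OF h(1) group_flat[OF assms(1,2)] assms(3)]
      hom_one[OF h(2) group_flat[OF assms(1,2)] assms(3)] by simp
next
  case (gen a x z)
  then show ?case
    using hom_mult[OF h(1) flat_gen_flat] hom_mult[OF h(2) flat_gen_flat] eq assms(1,2) by simp
qed

text \<open>\<open>H\<close> will be another kernel \<open>A' \<flat> X'\<close> inside its
  coproduct. That a morphism of coproducts restricts to the kernels is then checked on generators;
  this serves for \<open>f \<flat> g\<close>, for the monad multiplication and for the folding
  maps.\<close>

lemma hom_flat_restrict:
  assumes "group A" "group X" "group G" "subgroup (carrier H) G" "H = G\<lparr>carrier := carrier H\<rparr>"
    and h: "h \<in> hom (A \<amalg> X) G"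
    and gen: "\<And>a x. a \<in> carrier A \<Longrightarrow> x \<in> carrier X \<Longrightarrow> h (flat_gen A X a x) \<in> carrier H"
  shows "h \<in> hom (A \<flat> X) H"
proof -
  interpret H: subgroup "carrier H" G by fact
  have mult: "mult H = mult G" by (subst assms(5)) simp
  have "h z \<in> carrier H" if "z \<in> carrier (A \<flat> X)" for z
    using assms(1,2) that
  proof (induction rule: flat_induct)
    case one
    then show ?case using hom_one[OF h group_coprod[OF assms(1,2)] assms(3)] by simp
  next
    case (gen a x z)
    then show ?case
      using assms(7) hom_mult[OF h] by (simp add: flat_closed flat_gen_flat assms(1,2))
  qed
  then show ?thesis
    using hom_mult[OF h] by (auto intro!: homI simp: mult flat_closed)
qed

lemma hom_flat: "h \<in> hom (A \<amalg> X) G \<Longrightarrow> h \<in> hom (A \<flat> X) G"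
  by (auto simp: hom_def flat_closed)

section \<open>Automorphisms and semidirect products\<close>

lemma AutoGroup_carrier: "carrier (AutoGroup X) = auto X"
  by (simp add: AutoGroup_def)

lemma AutoGroup_mult_apply:
  "\<phi> \<in> carrier (AutoGroup X) \<Longrightarrow> \<psi> \<in> carrier (AutoGroup X) \<Longrightarrow> x \<in> carrier X
    \<Longrightarrow> (\<phi> \<otimes>\<^bsub>AutoGroup X\<^esub> \<psi>) x = \<phi> (\<psi> x)"
  by (simp add: AutoGroup_def BijGroup_def auto_def compose_eq)

lemma AutoGroup_one_apply: "x \<in> carrier X \<Longrightarrow> \<one>\<^bsub>AutoGroup X\<^esub> x = x"
  by (simp add: AutoGroup_def BijGroup_def)

lemma AutoGroup_hom: "\<phi> \<in> carrier (AutoGroup X) \<Longrightarrow> \<phi> \<in> hom X X"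
  by (simp add: AutoGroup_carrier auto_def)

text \<open>Elements of \<open>AutoGroup X\<close> are extensional, hence fixed by their values on
  the carrier.\<close>

lemma AutoGroup_eqI:
  assumes "\<phi> \<in> carrier (AutoGroup X)" "\<psi> \<in> carrier (AutoGroup X)"
    and "\<And>x. x \<in> carrier X \<Longrightarrow> \<phi> x = \<psi> x"
  shows "\<phi> = \<psi>"
  using assms by (auto simp: AutoGroup_carrier auto_def dest!: Bij_imp_extensional intro: extensionalityI)

lemma AutoGroup_eq_iff:
  "\<phi> \<in> carrier (AutoGroup X) \<Longrightarrow> \<psi> \<in> carrier (AutoGroup X)
    \<Longrightarrow> \<phi> = \<psi> \<longleftrightarrow> (\<forall>x \<in> carrier X. \<phi> x = \<psi> x)"
  using AutoGroup_eqI[of \<phi> X \<psi>] by blast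

lemma AutoGroupI:
  assumes "\<phi> \<in> hom X X" "\<phi> \<in> extensional (carrier X)"
    and "\<And>x. x \<in> carrier X \<Longrightarrow> \<psi> x \<in> carrier X"
    and "\<And>x. x \<in> carrier X \<Longrightarrow> \<phi> (\<psi> x) = x"
    and "\<And>x. x \<in> carrier X \<Longrightarrow> \<psi> (\<phi> x) = x"
  shows "\<phi> \<in> carrier (AutoGroup X)"
  using assms hom_in_carrier[OF assms(1)]
  by (auto simp: AutoGroup_carrier auto_def Bij_def intro!: bij_betwI[where g = \<psi>])

section \<open>Actions by automorphisms and their semidirect products\<close>

locale group_action_by_autos = A: group A + X: group X
  for A :: "('a, 'c) monoid_scheme" and X :: "('x, 'd) monoid_scheme" +
  fixes \<alpha> :: "'a \<Rightarrow> 'x \<Rightarrow> 'x"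
  assumes act_hom: "\<alpha> \<in> hom A (AutoGroup X)"
begin

lemma act_Auto: "a \<in> carrier A \<Longrightarrow> \<alpha> a \<in> carrier (AutoGroup X)"
  by (rule hom_in_carrier[OF act_hom])

lemma act_closed [simp]: "a \<in> carrier A \<Longrightarrow> x \<in> carrier X \<Longrightarrow> \<alpha> a x \<in> carrier X"
  by (rule hom_in_carrier[OF AutoGroup_hom[OF act_Auto]])

lemma act_mult:
  "a \<in> carrier A \<Longrightarrow> b \<in> carrier A \<Longrightarrow> x \<in> carrier X \<Longrightarrow> \<alpha> (a \<otimes>\<^bsub>A\<^esub> b) x = \<alpha> a (\<alpha> b x)"
  by (simp add: hom_mult[OF act_hom] AutoGroup_mult_apply act_Auto)

lemma act_one [simp]: "x \<in> carrier X \<Longrightarrow> \<alpha> \<one>\<^bsub>A\<^esub> x = x"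
  by (simp add: hom_one[OF act_hom A.is_group X.AutoGroup] AutoGroup_one_apply)

lemma act_distrib:
  "a \<in> carrier A \<Longrightarrow> x \<in> carrier X \<Longrightarrow> y \<in> carrier X
    \<Longrightarrow> \<alpha> a (x \<otimes>\<^bsub>X\<^esub> y) = \<alpha> a x \<otimes>\<^bsub>X\<^esub> \<alpha> a y"
  by (rule hom_mult[OF AutoGroup_hom[OF act_Auto]])

lemma act_unit [simp]: "a \<in> carrier A \<Longrightarrow> \<alpha> a \<one>\<^bsub>X\<^esub> = \<one>\<^bsub>X\<^esub>"
  by (rule hom_one[OF AutoGroup_hom[OF act_Auto] X.is_group X.is_group])

text \<open>The pair \<open>(x, a)\<close> stands for the product \<open>x a\<close>; the
  multiplication encodes the rule \<open>a y = (\<alpha> a y) a\<close>.\<close>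

definition semidirect :: "('x \<times> 'a) monoid" where
  "semidirect =
    \<lparr>carrier = carrier X \<times> carrier A,
     mult = (\<lambda>(x, a) (y, b). (x \<otimes>\<^bsub>X\<^esub> \<alpha> a y, a \<otimes>\<^bsub>A\<^esub> b)),
     one = (\<one>\<^bsub>X\<^esub>, \<one>\<^bsub>A\<^esub>)\<rparr>"

lemma semidirect_simps [simp]:
  "carrier semidirect = carrier X \<times> carrier A"
  "(x, a) \<otimes>\<^bsub>semidirect\<^esub> (y, b) = (x \<otimes>\<^bsub>X\<^esub> \<alpha> a y, a \<otimes>\<^bsub>A\<^esub> b)"
  "\<one>\<^bsub>semidirect\<^esub> = (\<one>\<^bsub>X\<^esub>, \<one>\<^bsub>A\<^esub>)"
  by (simp_all add: semidirect_def)

lemma group_semidirect: "group semidirect"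
proof (rule groupI)
  fix z assume "z \<in> carrier semidirect"
  then obtain x a where z: "z = (x, a)" "x \<in> carrier X" "a \<in> carrier A" by auto
  then show "\<exists>y\<in>carrier semidirect. y \<otimes>\<^bsub>semidirect\<^esub> z = \<one>\<^bsub>semidirect\<^esub>"
    \<comment> \<open>The witness is \<open>(x a)^-1 = a^-1 x^-1\<close>, with the factor from
      \<open>X\<close> moved to the left.\<close>
    by (intro bexI[of _ "(\<alpha> (inv\<^bsub>A\<^esub> a) (inv\<^bsub>X\<^esub> x), inv\<^bsub>A\<^esub> a)"]) (auto simp flip: act_distrib)
qed (auto simp: act_mult act_distrib X.m_assoc A.m_assoc)

text \<open>The two inclusions into the semidirect product induce a morphism \<open>c\<close> on the
  coproduct which commutes with the projections to \<open>A\<close>. So \<open>c\<close> maps the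
  kernel to pairs \<open>(x, 1)\<close>; since \<open>1\<close> acts trivially, the first component
  is multiplicative on these.\<close>

lemma ex_flat_hom:
  "\<exists>\<xi> \<in> hom (A \<flat> X) X. \<forall>a \<in> carrier A. \<forall>x \<in> carrier X. \<xi> (flat_gen A X a x) = \<alpha> a x"
proof -
  define E where "E = semidirect"
  interpret E: group E unfolding E_def by (rule group_semidirect)
  define f :: "'a \<Rightarrow> 'x \<times> 'a" where "f a = (\<one>\<^bsub>X\<^esub>, a)" for a
  define g :: "'x \<Rightarrow> 'x \<times> 'a" where "g x = (x, \<one>\<^bsub>A\<^esub>)" for x
  have f: "f \<in> hom A E" and g: "g \<in> hom X E"
    by (auto simp: f_def g_def E_def hom_def)
  have s: "snd \<in> hom E A" by (auto simp: E_def hom_def)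
  define c where "c = copair E f g"
  have c: "c \<in> hom (A \<amalg> X) E" unfolding c_def
    by (rule copair_hom[OF A.is_group X.is_group E.is_group f g])
  have c1: "c (incl1 A X a) = f a" if "a \<in> carrier A" for a
    unfolding c_def by (rule copair_incl1[OF A.is_group X.is_group E.is_group f g that])
  have c2: "c (incl2 A X x) = g x" if "x \<in> carrier X" for x
    unfolding c_def by (rule copair_incl2[OF A.is_group X.is_group E.is_group f g that])
  have "(snd \<circ> c) z = flat_proj A z" if "z \<in> carrier (A \<amalg> X)" for z
    by (rule coprod_hom_eqI[OF A.is_group X.is_group A.is_group hom_compose[OF c s]
          flat_proj_hom _ _ that])
      (auto simp: c1 c2 f_def g_def flat_proj_incl A.is_group X.is_group)
  then have snd: "snd (c z) = \<one>\<^bsub>A\<^esub>" if "z \<in> carrier (A \<flat> X)" for z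
    using that by (simp add: flat_carrier_iff)
  define \<xi> where "\<xi> z = fst (c z)" for z
  have cz: "c z = (\<xi> z, \<one>\<^bsub>A\<^esub>)" if "z \<in> carrier (A \<flat> X)" for z
    using snd[OF that] by (simp add: \<xi>_def prod_eq_iff)
  have \<xi>c: "\<xi> z \<in> carrier X" if "z \<in> carrier (A \<flat> X)" for z
    using hom_in_carrier[OF c flat_closed[OF that]] cz[OF that] by (simp add: E_def)
  have "\<xi> \<in> hom (A \<flat> X) X"
  proof (rule homI)
    fix y z assume yz: "y \<in> carrier (A \<flat> X)" "z \<in> carrier (A \<flat> X)"
    then have "c (y \<otimes>\<^bsub>A \<amalg> X\<^esub> z) = (\<xi> y, \<one>\<^bsub>A\<^esub>) \<otimes>\<^bsub>E\<^esub> (\<xi> z, \<one>\<^bsub>A\<^esub>)"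
      by (simp add: hom_mult[OF c] cz flat_closed)
    also have "\<dots> = (\<xi> y \<otimes>\<^bsub>X\<^esub> \<xi> z, \<one>\<^bsub>A\<^esub>)"
      using yz by (simp add: E_def \<xi>c)
    finally show "\<xi> (y \<otimes>\<^bsub>A \<flat> X\<^esub> z) = \<xi> y \<otimes>\<^bsub>X\<^esub> \<xi> z"
      by (simp add: \<xi>_def)
  qed (fact \<xi>c)
  moreover have "\<xi> (flat_gen A X a x) = \<alpha> a x" if a: "a \<in> carrier A" and x: "x \<in> carrier X" for a x
  proof -
    have "c (flat_gen A X a x) = f a \<otimes>\<^bsub>E\<^esub> g x \<otimes>\<^bsub>E\<^esub> f (inv\<^bsub>A\<^esub> a)"
      using a x group_coprod[OF A.is_group X.is_group]
      by (simp add: coprod_conj_def hom_mult[OF c] c1 c2 incl1_closed incl2_closed group.is_monoid monoid.m_closed)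
    also have "\<dots> = (\<alpha> a x, \<one>\<^bsub>A\<^esub>)"
      using a x by (simp add: f_def g_def E_def)
    finally show ?thesis by (simp add: \<xi>_def)
  qed
  ultimately show ?thesis by blast
qed

end

section \<open>Inner automorphisms\<close>

lemma conjugation_hom:
  assumes "group X"
  shows "conjugation X \<in> hom X (AutoGroup X)"
proof -
  interpret X: group X by fact
  have cancel: "inv\<^bsub>X\<^esub> x \<otimes>\<^bsub>X\<^esub> (x \<otimes>\<^bsub>X\<^esub> y) = y" "x \<otimes>\<^bsub>X\<^esub> (inv\<^bsub>X\<^esub> x \<otimes>\<^bsub>X\<^esub> y) = y"
    if "x \<in> carrier X" "y \<in> carrier X" for x y
    using that by (simp_all flip: X.m_assoc)
  have c: "conjugation X x \<in> carrier (AutoGroup X)" if x: "x \<in> carrier X" for x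
    by (rule AutoGroupI[where \<psi> = "conjugation X (inv\<^bsub>X\<^esub> x)"])
      (use x in \<open>auto simp: conjugation_def X.m_assoc cancel intro!: homI\<close>)
  show ?thesis
  proof (rule homI)
    fix x y assume xy: "x \<in> carrier X" "y \<in> carrier X"
    interpret Aut: group "AutoGroup X" by (rule X.AutoGroup)
    show "conjugation X (x \<otimes>\<^bsub>X\<^esub> y) = conjugation X x \<otimes>\<^bsub>AutoGroup X\<^esub> conjugation X y"
    proof (rule AutoGroup_eqI[where X = X])
      fix z assume "z \<in> carrier X"
      then show "conjugation X (x \<otimes>\<^bsub>X\<^esub> y) z = (conjugation X x \<otimes>\<^bsub>AutoGroup X\<^esub> conjugation X y) z"
        using xy
        by (simp add: c AutoGroup_mult_apply)
          (simp add: conjugation_def X.m_assoc X.inv_mult_group)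
    qed (use xy in \<open>simp_all add: c\<close>)
  qed (fact c)
qed

text \<open>An automorphism carries conjugation by \<open>x\<close> to conjugation by its image.
  This is why one half of (CA.M) and one half of (CA.N) hold for every pair of actions.\<close>

lemma AutoGroup_conj_conjugation:
  assumes "group X" "\<phi> \<in> carrier (AutoGroup X)" "x \<in> carrier X"
  shows "\<phi> \<otimes>\<^bsub>AutoGroup X\<^esub> conjugation X x \<otimes>\<^bsub>AutoGroup X\<^esub> inv\<^bsub>AutoGroup X\<^esub> \<phi> = conjugation X (\<phi> x)"
proof -
  interpret X: group X by fact
  interpret Aut: group "AutoGroup X" by (rule X.AutoGroup)
  note c = hom_in_carrier[OF conjugation_hom[OF assms(1)]]
  have hom: "\<phi> \<in> hom X X" by (rule AutoGroup_hom) fact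
  note \<phi>c = hom_in_carrier[OF hom]
  \<comment> \<open>With the inverse moved to the other side, both sides can be evaluated pointwise
    using only that \<open>\<phi>\<close> is a homomorphism.\<close>
  have "\<phi> \<otimes>\<^bsub>AutoGroup X\<^esub> conjugation X x = conjugation X (\<phi> x) \<otimes>\<^bsub>AutoGroup X\<^esub> \<phi>"
  proof (rule AutoGroup_eqI[where X = X])
    fix y assume "y \<in> carrier X"
    then show "(\<phi> \<otimes>\<^bsub>AutoGroup X\<^esub> conjugation X x) y
        = (conjugation X (\<phi> x) \<otimes>\<^bsub>AutoGroup X\<^esub> \<phi>) y"
      using assms(2,3)
      by (simp add: c \<phi>c AutoGroup_mult_apply)
        (simp add: conjugation_def \<phi>c hom_mult[OF hom] hom_inv_eq[OF assms(1,1) hom])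
  qed (use assms in \<open>simp_all add: c \<phi>c\<close>)
  then show ?thesis
    using Aut.inv_solve_right'[of "conjugation X (\<phi> x)" "\<phi> \<otimes>\<^bsub>AutoGroup X\<^esub> conjugation X x" \<phi>]
      assms(2,3) c \<phi>c Aut.m_closed by blast
qed

section \<open>Internal actions as group actions\<close>

lemma copair_flat_gen:
  assumes "group A" "group X" "group G" "f \<in> hom A G" "g \<in> hom X G" "a \<in> carrier A" "x \<in> carrier X"
  shows "copair G f g (flat_gen A X a x) = f a \<otimes>\<^bsub>G\<^esub> g x \<otimes>\<^bsub>G\<^esub> inv\<^bsub>G\<^esub> (f a)"
  using assms
  by (simp add: hom_coprod_conj[OF assms(1-3) copair_hom[OF assms(1-5)]] incl2_closed
      copair_incl1[OF assms(1-5)] copair_incl2[OF assms(1-5)])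

lemma coprod_map_flat_gen:
  assumes "group A" "group X" "group A'" "group X'" "f \<in> hom A A'" "g \<in> hom X X'"
    and "a \<in> carrier A" "x \<in> carrier X"
  shows "coprod_map A' X' f g (flat_gen A X a x) = flat_gen A' X' (f a) (g x)"
proof -
  note hom_in_carrier[OF assms(5,7)]
  then show ?thesis
    unfolding coprod_map_def
    using copair_flat_gen[OF assms(1,2) group_coprod[OF assms(3,4)] hom_compose[OF assms(5) incl1_hom]
        hom_compose[OF assms(6) incl2_hom] assms(7,8)]
    by (simp add: coprod_conj_def incl1_inv assms(3,4))
qed

lemma coprod_map_hom:
  assumes "group A" "group X" "group A'" "group X'" "f \<in> hom A A'" "g \<in> hom X X'"
  shows "coprod_map A' X' f g \<in> hom (A \<amalg> X) (A' \<amalg> X')"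
  unfolding coprod_map_def
  by (intro copair_hom group_coprod hom_compose[OF _ incl1_hom] hom_compose[OF _ incl2_hom] assms)

lemma coprod_map_flat_hom:
  assumes "group A" "group X" "group A'" "group X'" "f \<in> hom A A'" "g \<in> hom X X'"
  shows "coprod_map A' X' f g \<in> hom (A \<flat> X) (A' \<flat> X')"
  by (rule hom_flat_restrict[OF assms(1,2) group_coprod[OF assms(3,4)] flat_subgroup[OF assms(3,4)]
        flat_eq coprod_map_hom[OF assms]])
    (simp add: coprod_map_flat_gen[OF assms] flat_gen_flat assms(3,4)
      hom_in_carrier[OF assms(5)] hom_in_carrier[OF assms(6)])

lemma flat_incl_hom: "(\<lambda>z. z) \<in> hom (A \<flat> X) (A \<amalg> X)"
  by (rule hom_flat[OF id_hom])

text \<open>\<open>flat_mult\<close> reads a letter \<open>z\<close> taken from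
  \<open>A \<flat> X\<close> as the element \<open>z\<close> of the coproduct, so the formal
  conjugate becomes an actual one.\<close>

lemma flat_mult_flat_gen:
  assumes "group A" "group X" "a \<in> carrier A" "z \<in> carrier (A \<flat> X)"
  shows "flat_mult A X (flat_gen A (A \<flat> X) a z) = coprod_conj A X a z"
  unfolding flat_mult_def
  using copair_flat_gen[OF assms(1) group_flat[OF assms(1,2)] group_coprod[OF assms(1,2)] incl1_hom flat_incl_hom assms(3,4)]
  by (simp add: coprod_conj_def incl1_inv assms(1-3))

lemma flat_mult_hom:
  assumes "group A" "group X"
  shows "flat_mult A X \<in> hom (A \<flat> (A \<flat> X)) (A \<flat> X)"
proof (rule hom_flat_restrict[OF assms(1) group_flat[OF assms] group_coprod[OF assms] flat_subgroup[OF assms] flat_eq])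
  show "flat_mult A X \<in> hom (A \<amalg> (A \<flat> X)) (A \<amalg> X)"
    unfolding flat_mult_def
    by (intro copair_hom assms group_flat group_coprod incl1_hom flat_incl_hom)
qed (simp add: flat_mult_flat_gen assms coprod_conj_flat)

section \<open>Algebras for \<open>A \<flat> (-)\<close> and group actions\<close>

lemma internal_action_hom: "internal_action A X \<xi> \<Longrightarrow> \<xi> \<in> hom (A \<flat> X) X"
  by (simp add: internal_action_def)

lemma internal_action_incl2: "internal_action A X \<xi> \<Longrightarrow> x \<in> carrier X \<Longrightarrow> \<xi> (incl2 A X x) = x"
  by (simp add: internal_action_def flat_unit_def)

text \<open>This is the algebra law at the generator \<open>a z a^-1\<close> of
  \<open>A \<flat> (A \<flat> X)\<close>: the multiplication gives the conjugate of
  \<open>z\<close>, while the functor applied to \<open>\<xi>\<close> replaces the letter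
  \<open>z\<close> by \<open>\<xi> z\<close>.\<close>

lemma internal_action_coprod_conj:
  assumes "group A" "group X" "internal_action A X \<xi>" "a \<in> carrier A" "z \<in> carrier (A \<flat> X)"
  shows "\<xi> (coprod_conj A X a z) = \<xi> (flat_gen A X a (\<xi> z))"
proof -
  have "flat_gen A (A \<flat> X) a z \<in> carrier (A \<flat> (A \<flat> X))"
    using assms by (intro flat_gen_flat group_flat)
  then show ?thesis
    using assms
    by (auto simp: internal_action_def flat_mult_flat_gen
        coprod_map_flat_gen[OF assms(1) group_flat[OF assms(1,2)] assms(1,2) id_hom internal_action_hom[OF assms(3)]])
qed

lemma internal_action_of_flat_gen:
  "internal_action_of A X \<alpha> \<xi> \<Longrightarrow> a \<in> carrier A \<Longrightarrow> x \<in> carrier X \<Longrightarrow> \<xi> (flat_gen A X a x) = \<alpha> a x"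
  by (simp add: internal_action_of_def coprod_conj_def)

lemma internal_action_of_hom: "internal_action_of A X \<alpha> \<xi> \<Longrightarrow> \<xi> \<in> hom (A \<flat> X) X"
  by (simp add: internal_action_of_def internal_action_hom)

lemma internal_action_of_coprod_conj:
  assumes "group A" "group X" "internal_action_of A X \<alpha> \<xi>" "a \<in> carrier A" "z \<in> carrier (A \<flat> X)"
  shows "\<xi> (coprod_conj A X a z) = \<alpha> a (\<xi> z)"
  using assms internal_action_coprod_conj[OF assms(1,2) _ assms(4,5), of \<xi>]
    internal_action_of_flat_gen[OF assms(3,4) hom_in_carrier[OF internal_action_of_hom[OF assms(3)] assms(5)]]
  by (simp add: internal_action_of_def)

text \<open>The unit law is the prescribed value at \<open>a = 1\<close>. Both sides of the
  multiplication law are morphisms on \<open>A \<flat> (A \<flat> X)\<close>, and on its generators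
  the law says that \<open>\<xi>\<close> is equivariant.\<close>

lemma (in group_action_by_autos) internal_action_ofI:
  assumes \<xi>: "\<xi> \<in> hom (A \<flat> X) X"
    and gen: "\<And>a x. a \<in> carrier A \<Longrightarrow> x \<in> carrier X \<Longrightarrow> \<xi> (flat_gen A X a x) = \<alpha> a x"
  shows "internal_action_of A X \<alpha> \<xi>"
proof -
  note AX = A.is_group X.is_group
  note F = group_flat[OF AX]
  have map: "coprod_map A X (\<lambda>a. a) \<xi> \<in> hom (A \<flat> (A \<flat> X)) (A \<flat> X)"
    by (rule coprod_map_flat_hom[OF AX(1) F AX id_hom \<xi>])
  \<comment> \<open>Equivariance: for fixed \<open>a\<close> both sides are morphisms in
    \<open>z\<close>, and on a generator \<open>b x b^-1\<close> both give
    \<open>\<alpha> (a b) x\<close>.\<close>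
  have conj: "\<xi> (coprod_conj A X a z) = \<alpha> a (\<xi> z)" if a: "a \<in> carrier A" and z: "z \<in> carrier (A \<flat> X)" for a z
  proof -
    have ch: "coprod_conj A X a \<in> hom (A \<flat> X) (A \<flat> X)"
      using a by (auto intro!: homI simp: coprod_conj_flat coprod_conj_distrib flat_closed AX)
    have "(\<xi> \<circ> coprod_conj A X a) z = (\<alpha> a \<circ> \<xi>) z"
      by (rule flat_hom_eqI[OF AX AX(2) hom_compose[OF ch \<xi>]
            hom_compose[OF \<xi> AutoGroup_hom[OF act_Auto[OF a]]] _ z])
        (use a in \<open>simp add: gen act_mult incl2_closed AX flip: coprod_conj_mult\<close>)
    then show ?thesis by simp
  qed
  have "\<xi> (flat_unit A X x) = x" if "x \<in> carrier X" for x
    using gen[of "\<one>\<^bsub>A\<^esub>" x] that by (simp add: flat_unit_def coprod_conj_one AX incl2_closed)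
  moreover have "\<xi> (flat_mult A X z) = \<xi> (coprod_map A X (\<lambda>a. a) \<xi> z)"
    if z: "z \<in> carrier (A \<flat> (A \<flat> X))" for z
  proof -
    have "(\<xi> \<circ> flat_mult A X) z = (\<xi> \<circ> coprod_map A X (\<lambda>a. a) \<xi>) z"
      by (rule flat_hom_eqI[OF AX(1) F AX(2) hom_compose[OF flat_mult_hom[OF AX] \<xi>]
            hom_compose[OF map \<xi>] _ z])
        (simp add: flat_mult_flat_gen AX coprod_map_flat_gen[OF AX(1) F AX id_hom \<xi>] conj gen
          hom_in_carrier[OF \<xi>])
    then show ?thesis by simp
  qed
  ultimately show ?thesis
    using \<xi> gen by (simp add: internal_action_of_def internal_action_def coprod_conj_def)
qed

lemma ex_internal_action_of:
  assumes "group A" "group X" "\<alpha> \<in> hom A (AutoGroup X)"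
  shows "\<exists>\<xi>. internal_action_of A X \<alpha> \<xi>"
proof -
  interpret group_action_by_autos A X \<alpha>
    using assms by (simp add: group_action_by_autos_def group_action_by_autos_axioms_def)
  show ?thesis using ex_flat_hom internal_action_ofI by blast
qed

lemma internal_action_of_conj_action:
  assumes "group X"
  shows "internal_action_of X X (conjugation X) (conj_action X)"
proof -
  interpret group_action_by_autos X X "conjugation X"
    using assms conjugation_hom by (simp add: group_action_by_autos_def group_action_by_autos_axioms_def)
  show ?thesis
    by (rule internal_action_ofI)
      (simp_all add: conj_action_def hom_flat copair_hom assms id_hom
        copair_flat_gen[OF assms assms assms id_hom id_hom] conjugation_def)
qed

lemma internal_action_ex_action:
  assumes "group A" "group X" "internal_action A X \<xi>"
  obtains \<alpha> where "\<alpha> \<in> hom A (AutoGroup X)" "internal_action_of A X \<alpha> \<xi>"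
proof -
  interpret A: group A by fact
  interpret X: group X by fact
  note \<xi> = internal_action_hom[OF assms(3)]
  \<comment> \<open>The restriction to the carrier makes \<open>\<alpha> a\<close> extensional, as
    membership in \<open>AutoGroup X\<close> requires.\<close>
  define \<alpha> where "\<alpha> a = (\<lambda>x\<in>carrier X. \<xi> (flat_gen A X a x))" for a
  have \<alpha>: "\<alpha> a x = \<xi> (flat_gen A X a x)" if "x \<in> carrier X" for a x
    using that by (simp add: \<alpha>_def)
  have closed: "\<alpha> a x \<in> carrier X" if "a \<in> carrier A" "x \<in> carrier X" for a x
    using that by (simp add: \<alpha> hom_in_carrier[OF \<xi>] flat_gen_flat assms)
  \<comment> \<open>The multiplication law of the algebra yields \<open>mult\<close>, the unit law
    yields \<open>one\<close>, and multiplicativity of \<open>\<xi>\<close> makes each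
    \<open>\<alpha> a\<close> an endomorphism; its inverse is then \<open>\<alpha>\<close> at the
    inverse of \<open>a\<close>.\<close>
  have mult: "\<alpha> (a \<otimes>\<^bsub>A\<^esub> b) x = \<alpha> a (\<alpha> b x)"
    if "a \<in> carrier A" "b \<in> carrier A" "x \<in> carrier X" for a b x
    using that closed
    by (simp add: \<alpha> coprod_conj_mult incl2_closed assms internal_action_coprod_conj flat_gen_flat)
  have one: "\<alpha> \<one>\<^bsub>A\<^esub> x = x" if "x \<in> carrier X" for x
    using that by (simp add: \<alpha> coprod_conj_one incl2_closed assms internal_action_incl2[OF assms(3)])
  have hom: "\<alpha> a \<in> hom X X" if "a \<in> carrier A" for a
    using that closed
    by (auto intro!: homI simp: \<alpha> hom_mult[OF incl2_hom] coprod_conj_distrib incl2_closed assms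
        hom_mult[OF \<xi>, simplified] flat_gen_flat)
  have aut: "\<alpha> a \<in> carrier (AutoGroup X)" if "a \<in> carrier A" for a
    by (rule AutoGroupI[where \<psi> = "\<alpha> (inv\<^bsub>A\<^esub> a)"])
      (use that hom closed in \<open>simp_all flip: mult add: one\<close>, simp add: \<alpha>_def)
  show ?thesis
  proof (rule that)
    show "\<alpha> \<in> hom A (AutoGroup X)"
    proof (rule homI)
      fix a b assume ab: "a \<in> carrier A" "b \<in> carrier A"
      interpret Aut: group "AutoGroup X" by (rule X.AutoGroup)
      show "\<alpha> (a \<otimes>\<^bsub>A\<^esub> b) = \<alpha> a \<otimes>\<^bsub>AutoGroup X\<^esub> \<alpha> b"
        by (rule AutoGroup_eqI[where X = X]) (use ab in \<open>simp_all add: aut mult AutoGroup_mult_apply\<close>)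
    qed (fact aut)
    show "internal_action_of A X \<alpha> \<xi>"
      using assms(3) by (simp add: internal_action_of_def \<alpha> flip: coprod_conj_def)
  qed
qed

text \<open>Restriction of an action along \<open>F\<close>. It covers both the equations of (CA.0)
  with \<open>F\<close> an inclusion into \<open>M \<amalg> N\<close> and the two sides of (CA.M)
  and (CA.N).\<close>

lemma internal_action_of_pullback:
  assumes "group Q" "group P" "group X" "internal_action_of P X \<gamma> \<zeta>" "F \<in> hom Q P"
  shows "(\<lambda>z. \<zeta> (coprod_map P X F (\<lambda>x. x) z)) \<in> hom (Q \<flat> X) X"
    and "q \<in> carrier Q \<Longrightarrow> x \<in> carrier X \<Longrightarrow>
      \<zeta> (coprod_map P X F (\<lambda>x. x) (flat_gen Q X q x)) = \<gamma> (F q) x"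
  using hom_compose[OF coprod_map_flat_hom[OF assms(1,3,2,3,5) id_hom] internal_action_of_hom[OF assms(4)]]
  by (simp_all add: comp_def coprod_map_flat_gen[OF assms(1,3,2,3,5) id_hom]
      internal_action_of_flat_gen[OF assms(4)] hom_in_carrier[OF assms(5)])

lemma pullback_eq_internal_action:
  assumes "group Q" "group P" "group X" "internal_action_of P X \<gamma> \<zeta>" "F \<in> hom Q P"
    and "internal_action_of Q X \<alpha> \<xi>"
    and "\<And>q x. q \<in> carrier Q \<Longrightarrow> x \<in> carrier X \<Longrightarrow> \<gamma> (F q) x = \<alpha> q x"
    and "z \<in> carrier (Q \<flat> X)"
  shows "\<zeta> (coprod_map P X F (\<lambda>x. x) z) = \<xi> z"
  by (rule flat_hom_eqI[OF assms(1,3,3) internal_action_of_pullback(1)[OF assms(1-5)]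
        internal_action_of_hom[OF assms(6)] _ assms(8)])
    (simp add: internal_action_of_pullback(2)[OF assms(1-5)] internal_action_of_flat_gen[OF assms(6)] assms(7))

text \<open>On the generator \<open>q x q^-1\<close> the two sides are
  \<open>\<gamma> (F q) x\<close> and \<open>\<gamma> (G q) x\<close>. This turns (CA.M) and (CA.N)
  into equations between morphisms into the automorphism group.\<close>

lemma pullback_eq_iff:
  assumes "group Q" "group P" "group X" "internal_action_of P X \<gamma> \<zeta>" "\<gamma> \<in> hom P (AutoGroup X)"
    and "F \<in> hom Q P" "G \<in> hom Q P"
  shows "(\<forall>z \<in> carrier (Q \<flat> X). \<zeta> (coprod_map P X F (\<lambda>x. x) z) = \<zeta> (coprod_map P X G (\<lambda>x. x) z))
    \<longleftrightarrow> (\<forall>q \<in> carrier Q. \<gamma> (F q) = \<gamma> (G q))" (is "?L \<longleftrightarrow> ?R")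
proof
  note F = internal_action_of_pullback[OF assms(1-4,6)]
  note G = internal_action_of_pullback[OF assms(1-4,7)]
  show ?R if ?L
  proof
    fix q assume q: "q \<in> carrier Q"
    show "\<gamma> (F q) = \<gamma> (G q)"
    proof (rule AutoGroup_eqI[where X = X])
      fix x assume "x \<in> carrier X"
      then show "\<gamma> (F q) x = \<gamma> (G q) x"
        using q that flat_gen_flat[OF assms(1,3) q] F(2)[OF q] G(2)[OF q] by metis
    qed (use q assms(5-7) in \<open>auto intro: hom_in_carrier\<close>)
  qed
  show ?L if ?R
  proof
    fix z assume z: "z \<in> carrier (Q \<flat> X)"
    show "\<zeta> (coprod_map P X F (\<lambda>x. x) z) = \<zeta> (coprod_map P X G (\<lambda>x. x) z)"
      by (rule flat_hom_eqI[OF assms(1,3,3) F(1) G(1) _ z]) (use that in \<open>simp add: F(2) G(2)\<close>)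
  qed
qed

text \<open>By induction on \<open>w\<close>: conjugation by a letter \<open>a\<close> becomes
  \<open>\<alpha> a\<close> by equivariance. A letter \<open>x\<close> of \<open>X\<close> itself
  lies in the kernel, where \<open>\<xi>\<close> is multiplicative and sends it to \<open>x\<close>,
  so it becomes conjugation in \<open>X\<close>.\<close>

lemma internal_action_of_coprod_act:
  assumes "group A" "group X" "\<alpha> \<in> hom A (AutoGroup X)" "internal_action_of A X \<alpha> \<xi>"
    and "w \<in> carrier (A \<amalg> X)" "z \<in> carrier (A \<flat> X)"
  shows "w \<otimes>\<^bsub>A \<amalg> X\<^esub> z \<otimes>\<^bsub>A \<amalg> X\<^esub> inv\<^bsub>A \<amalg> X\<^esub> w \<in> carrier (A \<flat> X)"
    and "\<xi> (w \<otimes>\<^bsub>A \<amalg> X\<^esub> z \<otimes>\<^bsub>A \<amalg> X\<^esub> inv\<^bsub>A \<amalg> X\<^esub> w)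
      = copair (AutoGroup X) \<alpha> (conjugation X) w (\<xi> z)"
proof -
  interpret A: group A by fact
  interpret X: group X by fact
  interpret C: group "A \<amalg> X" using assms by (intro group_coprod)
  interpret Aut: group "AutoGroup X" by (rule X.AutoGroup)
  note AX = assms(1,2)
  note \<xi> = internal_action_of_hom[OF assms(4)]
  note FG = AX Aut.is_group assms(3) conjugation_hom[OF AX(2)]
  define \<gamma> where "\<gamma> = copair (AutoGroup X) \<alpha> (conjugation X)"
  have \<gamma>: "\<gamma> \<in> hom (A \<amalg> X) (AutoGroup X)"
    unfolding \<gamma>_def by (rule copair_hom[OF FG])
  note \<gamma>c = hom_in_carrier[OF \<gamma>]
  let ?c = "\<lambda>w. w \<otimes>\<^bsub>A \<amalg> X\<^esub> z \<otimes>\<^bsub>A \<amalg> X\<^esub> inv\<^bsub>A \<amalg> X\<^esub> w"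
  note zc = flat_closed[OF assms(6)]
  have "?c w \<in> carrier (A \<flat> X) \<and> \<xi> (?c w) = \<gamma> w (\<xi> z)"
    using assms(5)
  proof (induction rule: coprod_induct)
    case one
    show ?case
      using assms(6) zc hom_in_carrier[OF \<xi>]
      by (simp add: hom_one[OF \<gamma> C.is_group Aut.is_group] AutoGroup_one_apply)
  next
    case (incl1 a w)
    have "?c (incl1 A X a \<otimes>\<^bsub>A \<amalg> X\<^esub> w) = coprod_conj A X a (?c w)"
      using incl1(1,2) zc
      by (simp add: coprod_conj_def incl1_closed incl1_inv AX C.inv_mult_group C.m_assoc)
    moreover have "\<gamma> (incl1 A X a \<otimes>\<^bsub>A \<amalg> X\<^esub> w) (\<xi> z) = \<alpha> a (\<gamma> w (\<xi> z))"
      using incl1(1,2) hom_in_carrier[OF \<xi> assms(6)] \<gamma>c[OF incl1_closed[OF incl1(1)]]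
      by (simp add: hom_mult[OF \<gamma>] incl1_closed \<gamma>c AutoGroup_mult_apply)
        (simp add: \<gamma>_def copair_incl1[OF FG])
    ultimately show ?case
      using incl1 internal_action_of_coprod_conj[OF AX assms(4)] coprod_conj_flat[OF AX] by simp
  next
    case (incl2 x w)
    have i: "incl2 A X x \<in> carrier (A \<flat> X)" "inv\<^bsub>A \<amalg> X\<^esub> incl2 A X x = incl2 A X (inv\<^bsub>X\<^esub> x)"
      using incl2(1) by (simp_all add: incl2_flat AX hom_inv_eq[OF AX(2) C.is_group incl2_hom])
    have ix: "incl2 A X (inv\<^bsub>X\<^esub> x) \<in> carrier (A \<flat> X)"
      using incl2(1) by (simp add: incl2_flat AX)
    have eq: "?c (incl2 A X x \<otimes>\<^bsub>A \<amalg> X\<^esub> w)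
        = incl2 A X x \<otimes>\<^bsub>A \<amalg> X\<^esub> ?c w \<otimes>\<^bsub>A \<amalg> X\<^esub> incl2 A X (inv\<^bsub>X\<^esub> x)"
      using incl2(1,2) zc
      by (simp add: incl2_closed C.inv_mult_group C.m_assoc flip: i(2))
    interpret F: group "A \<flat> X" by (rule group_flat[OF AX])
    have F: "u \<otimes>\<^bsub>A \<amalg> X\<^esub> v \<in> carrier (A \<flat> X)" "\<xi> (u \<otimes>\<^bsub>A \<amalg> X\<^esub> v) = \<xi> u \<otimes>\<^bsub>X\<^esub> \<xi> v"
      if "u \<in> carrier (A \<flat> X)" "v \<in> carrier (A \<flat> X)" for u v
      using F.m_closed[OF that] hom_mult[OF \<xi> that] by simp_all
    have "\<gamma> (incl2 A X x \<otimes>\<^bsub>A \<amalg> X\<^esub> w) (\<xi> z) = conjugation X x (\<gamma> w (\<xi> z))"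
      using incl2(1,2) hom_in_carrier[OF \<xi> assms(6)] \<gamma>c[OF incl2_closed[OF incl2(1)]]
      by (simp add: hom_mult[OF \<gamma>] incl2_closed \<gamma>c AutoGroup_mult_apply)
        (simp add: \<gamma>_def copair_incl2[OF FG])
    moreover have "\<gamma> w (\<xi> z) \<in> carrier X"
      by (rule hom_in_carrier[OF AutoGroup_hom[OF \<gamma>c[OF incl2(2)]] hom_in_carrier[OF \<xi> assms(6)]])
    moreover have "\<xi> (incl2 A X y) = y" if "y \<in> carrier X" for y
      using assms(4) that by (simp add: internal_action_of_def internal_action_incl2)
    ultimately show ?case
      using incl2 i(1) ix by (simp only: eq) (simp add: F conjugation_def)
  qed
  then show "?c w \<in> carrier (A \<flat> X)" "\<xi> (?c w) = copair (AutoGroup X) \<alpha> (conjugation X) w (\<xi> z)"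
    by (simp_all add: \<gamma>_def)
qed

section \<open>Actions of a coproduct\<close>

text \<open>The group action \<open>\<delta>\<close> behind \<open>\<zeta>\<close> is a morphism on
  \<open>A \<amalg> B\<close>, hence determined by the letters; the last two assumptions, read on
  generators, give its values there. Thus the first two equations of each triple in (CA.0) leave
  only the induced action.\<close>

lemma internal_action_of_copair:
  assumes "group A" "group B" "group X" "f \<in> hom A (AutoGroup X)" "g \<in> hom B (AutoGroup X)"
    and "internal_action (A \<amalg> B) X \<zeta>"
    and "internal_action_of A X f \<xi>" "internal_action_of B X g \<xi>'"
    and "\<forall>z \<in> carrier (A \<flat> X). \<zeta> (coprod_map (A \<amalg> B) X (incl1 A B) (\<lambda>x. x) z) = \<xi> z"
    and "\<forall>z \<in> carrier (B \<flat> X). \<zeta> (coprod_map (A \<amalg> B) X (incl2 A B) (\<lambda>x. x) z) = \<xi>' z"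
  shows "internal_action_of (A \<amalg> B) X (copair (AutoGroup X) f g) \<zeta>"
proof -
  note P = group_coprod[OF assms(1,2)] and Aut = group.AutoGroup[OF assms(3)]
  note FG = assms(1,2) Aut assms(4,5)
  obtain \<delta> where \<delta>: "\<delta> \<in> hom (A \<amalg> B) (AutoGroup X)" "internal_action_of (A \<amalg> B) X \<delta> \<zeta>"
    using internal_action_ex_action[OF P assms(3,6)] by blast
  have "\<delta> p = copair (AutoGroup X) f g p" if p: "p \<in> carrier (A \<amalg> B)" for p
  proof (rule coprod_hom_eqI[OF assms(1,2) Aut \<delta>(1) copair_hom[OF FG] _ _ p])
    fix a assume a: "a \<in> carrier A"
    show "\<delta> (incl1 A B a) = copair (AutoGroup X) f g (incl1 A B a)"
    proof (rule AutoGroup_eqI[where X = X])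
      fix x assume x: "x \<in> carrier X"
      show "\<delta> (incl1 A B a) x = copair (AutoGroup X) f g (incl1 A B a) x"
        using internal_action_of_pullback(2)[OF assms(1) P assms(3) \<delta>(2) incl1_hom a x]
          bspec[OF assms(9) flat_gen_flat[OF assms(1,3) a x]] internal_action_of_flat_gen[OF assms(7) a x]
          copair_incl1[OF FG a] by simp
    qed (simp_all add: a incl1_closed hom_in_carrier[OF \<delta>(1)] hom_in_carrier[OF copair_hom[OF FG]])
  next
    fix b assume b: "b \<in> carrier B"
    show "\<delta> (incl2 A B b) = copair (AutoGroup X) f g (incl2 A B b)"
    proof (rule AutoGroup_eqI[where X = X])
      fix x assume x: "x \<in> carrier X"
      show "\<delta> (incl2 A B b) x = copair (AutoGroup X) f g (incl2 A B b) x"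
        using internal_action_of_pullback(2)[OF assms(2) P assms(3) \<delta>(2) incl2_hom b x]
          bspec[OF assms(10) flat_gen_flat[OF assms(2,3) b x]] internal_action_of_flat_gen[OF assms(8) b x]
          copair_incl2[OF FG b] by simp
    qed (simp_all add: b incl2_closed hom_in_carrier[OF \<delta>(1)] hom_in_carrier[OF copair_hom[OF FG]])
  qed
  then show ?thesis
    using \<delta>(2) by (simp add: internal_action_of_def)
qed

lemma copair_pullback:
  assumes "group A" "group B" "group X" "f \<in> hom A (AutoGroup X)" "g \<in> hom B (AutoGroup X)"
    and "internal_action_of (A \<amalg> B) X (copair (AutoGroup X) f g) \<zeta>"
  shows "internal_action_of A X f \<xi> \<Longrightarrow> z \<in> carrier (A \<flat> X) \<Longrightarrow>
      \<zeta> (coprod_map (A \<amalg> B) X (incl1 A B) (\<lambda>x. x) z) = \<xi> z"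
    and "internal_action_of B X g \<xi>' \<Longrightarrow> z' \<in> carrier (B \<flat> X) \<Longrightarrow>
      \<zeta> (coprod_map (A \<amalg> B) X (incl2 A B) (\<lambda>x. x) z') = \<xi>' z'"
proof -
  note P = group_coprod[OF assms(1,2)] and Aut = group.AutoGroup[OF assms(3)]
  note FG = assms(1,2) Aut assms(4,5)
  show "\<zeta> (coprod_map (A \<amalg> B) X (incl1 A B) (\<lambda>x. x) z) = \<xi> z"
    if "internal_action_of A X f \<xi>" "z \<in> carrier (A \<flat> X)"
    by (rule pullback_eq_internal_action[OF assms(1) P assms(3,6) incl1_hom that(1) _ that(2)])
      (simp add: copair_incl1[OF FG])
  show "\<zeta> (coprod_map (A \<amalg> B) X (incl2 A B) (\<lambda>x. x) z') = \<xi>' z'"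
    if "internal_action_of B X g \<xi>'" "z' \<in> carrier (B \<flat> X)"
    by (rule pullback_eq_internal_action[OF assms(2) P assms(3,6) incl2_hom that(1) _ that(2)])
      (simp add: copair_incl2[OF FG])
qed

text \<open>This gives the folding equations of (CA.0) on all of \<open>(M \<amalg> N) \<flat> X\<close>, not only on the
  ternary cosmash product; they hold for any pair of actions.\<close>

lemma internal_action_of_fold:
  assumes "group A" "group X" "\<alpha> \<in> hom A (AutoGroup X)" "internal_action_of A X \<alpha> \<xi>"
    and "group P" "s \<in> hom P (A \<amalg> X)" "internal_action_of P X \<gamma> \<zeta>"
    and "\<And>p. p \<in> carrier P \<Longrightarrow> \<gamma> p = copair (AutoGroup X) \<alpha> (conjugation X) (s p)"
    and "z \<in> carrier (P \<flat> X)"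
  shows "\<zeta> z = \<xi> (copair (A \<amalg> X) s (incl2 A X) z)"
proof -
  note AX = group_coprod[OF assms(1,2)]
  note gen = copair_flat_gen[OF assms(5,2) AX assms(6) incl2_hom]
  note act = internal_action_of_coprod_act[OF assms(1-4) hom_in_carrier[OF assms(6)] incl2_flat[OF assms(1,2)]]
  \<comment> \<open>A generator \<open>p x p^-1\<close> goes to the conjugate of the letter
    \<open>x\<close> by \<open>s p\<close>, which lies in \<open>A \<flat> X\<close>; the previous
    lemma on conjugation also computes \<open>\<xi>\<close> there.\<close>
  have "copair (A \<amalg> X) s (incl2 A X) \<in> hom (P \<flat> X) (A \<flat> X)"
    by (rule hom_flat_restrict[OF assms(5,2) AX flat_subgroup[OF assms(1,2)] flat_eq
          copair_hom[OF assms(5,2) AX assms(6) incl2_hom]])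
      (simp add: gen act(1))
  note h = hom_compose[OF this internal_action_of_hom[OF assms(4)]]
  have "\<zeta> z = (\<xi> \<circ> copair (A \<amalg> X) s (incl2 A X)) z"
    by (rule flat_hom_eqI[OF assms(5,2,2) internal_action_of_hom[OF assms(7)] h _ assms(9)])
      (use assms(4) in \<open>simp add: gen act(2) internal_action_of_flat_gen[OF assms(7)] assms(8)
        internal_action_of_def internal_action_incl2\<close>)
  then show ?thesis by simp
qed

lemma cosmash3_flat:
  "group A \<Longrightarrow> group B \<Longrightarrow> group C \<Longrightarrow> z \<in> carrier (cosmash3 A B C) \<Longrightarrow> z \<in> carrier ((A \<amalg> B) \<flat> C)"
  using cosmash3_subset_flat by blast

section \<open>Compatibility\<close>

lemma coprod_swap_hom: "group A \<Longrightarrow> group B \<Longrightarrow> coprod_swap A B \<in> hom (A \<amalg> B) (B \<amalg> A)"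
  unfolding coprod_swap_def by (intro copair_hom group_coprod incl1_hom incl2_hom)

text \<open>Two morphisms on a coproduct of kernels agree iff they agree on the generators of each
  kernel: \<open>n m n^-1\<close> in \<open>N \<flat> M\<close> gives \<open>?R1\<close>, and
  \<open>m n m^-1\<close> in \<open>M \<flat> N\<close> gives \<open>?R2\<close>. The swap rewrites
  words of \<open>N \<amalg> M\<close> in \<open>M \<amalg> N\<close>.\<close>

lemma hom_coprod_map_eq_copair_swap_iff:
  assumes "group M" "group N" "internal_action_of M N \<alpha> \<xi>MN" "internal_action_of N M \<beta> \<xi>NM"
    and "group G" "\<gamma> \<in> hom (M \<amalg> N) G"
  shows "(\<forall>q \<in> carrier ((N \<flat> M) \<amalg> (M \<flat> N)).
      \<gamma> (coprod_map M N \<xi>NM \<xi>MN q) = \<gamma> (copair (M \<amalg> N) (coprod_swap N M) (\<lambda>y. y) q)) \<longleftrightarrow>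
    (\<forall>n \<in> carrier N. \<forall>m \<in> carrier M. \<gamma> (incl1 M N (\<beta> n m)) =
      \<gamma> (incl2 M N n) \<otimes>\<^bsub>G\<^esub> \<gamma> (incl1 M N m) \<otimes>\<^bsub>G\<^esub> inv\<^bsub>G\<^esub> (\<gamma> (incl2 M N n))) \<and>
    (\<forall>m \<in> carrier M. \<forall>n \<in> carrier N. \<gamma> (incl2 M N (\<alpha> m n)) =
      \<gamma> (incl1 M N m) \<otimes>\<^bsub>G\<^esub> \<gamma> (incl2 M N n) \<otimes>\<^bsub>G\<^esub> inv\<^bsub>G\<^esub> (\<gamma> (incl1 M N m)))"
    (is "?L \<longleftrightarrow> ?R1 \<and> ?R2")
proof -
  note MN = assms(1,2) and NM = assms(2,1)
  note P = group_coprod[OF MN]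
  note F = group_flat[OF NM] group_flat[OF MN]
  note \<xi>NM = internal_action_of_hom[OF assms(4)] and \<xi>MN = internal_action_of_hom[OF assms(3)]
  note swap = coprod_swap_hom[OF NM]
  note swap_flat = hom_flat[OF swap]
  let ?f = "coprod_map M N \<xi>NM \<xi>MN" and ?g = "copair (M \<amalg> N) (coprod_swap N M) (\<lambda>y. y)"
  have f: "?f \<in> hom ((N \<flat> M) \<amalg> (M \<flat> N)) (M \<amalg> N)"
    by (rule coprod_map_hom[OF F MN \<xi>NM \<xi>MN])
  have g: "?g \<in> hom ((N \<flat> M) \<amalg> (M \<flat> N)) (M \<amalg> N)"
    by (rule copair_hom[OF F P swap_flat flat_incl_hom])
  note \<gamma>f = hom_compose[OF f assms(6)] and \<gamma>g = hom_compose[OF g assms(6)]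
  have f1: "?f (incl1 (N \<flat> M) (M \<flat> N) u) = incl1 M N (\<xi>NM u)" if "u \<in> carrier (N \<flat> M)" for u
    using copair_incl1[OF F P hom_compose[OF \<xi>NM incl1_hom] hom_compose[OF \<xi>MN incl2_hom] that]
    by (simp add: coprod_map_def)
  have f2: "?f (incl2 (N \<flat> M) (M \<flat> N) v) = incl2 M N (\<xi>MN v)" if "v \<in> carrier (M \<flat> N)" for v
    using copair_incl2[OF F P hom_compose[OF \<xi>NM incl1_hom] hom_compose[OF \<xi>MN incl2_hom] that]
    by (simp add: coprod_map_def)
  note g1 = copair_incl1[OF F P swap_flat flat_incl_hom]
    and g2 = copair_incl2[OF F P swap_flat flat_incl_hom]
  have \<gamma>swap: "\<gamma> (coprod_swap N M (flat_gen N M n m)) =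
      \<gamma> (incl2 M N n) \<otimes>\<^bsub>G\<^esub> \<gamma> (incl1 M N m) \<otimes>\<^bsub>G\<^esub> inv\<^bsub>G\<^esub> (\<gamma> (incl2 M N n))"
    if "n \<in> carrier N" "m \<in> carrier M" for n m
    using hom_coprod_conj[OF NM assms(5) hom_compose[OF swap assms(6)] that(1) incl2_closed[OF that(2)]] that
    by (simp add: coprod_swap_def copair_incl1[OF NM P incl2_hom incl1_hom] copair_incl2[OF NM P incl2_hom incl1_hom])
  have \<gamma>gen: "\<gamma> (flat_gen M N m n) =
      \<gamma> (incl1 M N m) \<otimes>\<^bsub>G\<^esub> \<gamma> (incl2 M N n) \<otimes>\<^bsub>G\<^esub> inv\<^bsub>G\<^esub> (\<gamma> (incl1 M N m))"
    if "m \<in> carrier M" "n \<in> carrier N" for m n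
    by (rule hom_coprod_conj[OF MN assms(5,6) that(1) incl2_closed[OF that(2)]])
  note eqNM = internal_action_of_flat_gen[OF assms(4)] and eqMN = internal_action_of_flat_gen[OF assms(3)]
  show ?thesis
  proof
    assume L: ?L
    have "\<gamma> (incl1 M N (\<beta> n m)) = \<gamma> (coprod_swap N M (flat_gen N M n m))"
      if "n \<in> carrier N" "m \<in> carrier M" for n m
      using bspec[OF L incl1_closed[OF flat_gen_flat[OF NM that]]] flat_gen_flat[OF NM that]
      by (simp add: f1 g1 eqNM that)
    moreover have "\<gamma> (incl2 M N (\<alpha> m n)) = \<gamma> (flat_gen M N m n)"
      if "m \<in> carrier M" "n \<in> carrier N" for m n
      using bspec[OF L incl2_closed[OF flat_gen_flat[OF MN that]]] flat_gen_flat[OF MN that]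
      by (simp add: f2 g2 eqMN that)
    ultimately show "?R1 \<and> ?R2" by (simp add: \<gamma>swap \<gamma>gen)
  next
    assume R: "?R1 \<and> ?R2"
    \<comment> \<open>\<open>1\<close> and \<open>2\<close> extend the two equations from generators
      to the whole kernels.\<close>
    have 1: "(\<gamma> \<circ> incl1 M N \<circ> \<xi>NM) u = (\<gamma> \<circ> coprod_swap N M) u" if u: "u \<in> carrier (N \<flat> M)" for u
      by (rule flat_hom_eqI[OF NM assms(5) hom_compose[OF \<xi>NM hom_compose[OF incl1_hom assms(6)]]
            hom_compose[OF swap_flat assms(6)] _ u])
        (use R in \<open>simp add: eqNM \<gamma>swap\<close>)
    have 2: "(\<gamma> \<circ> incl2 M N \<circ> \<xi>MN) v = \<gamma> v" if v: "v \<in> carrier (M \<flat> N)" for v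
      by (rule flat_hom_eqI[OF MN assms(5) hom_compose[OF \<xi>MN hom_compose[OF incl2_hom assms(6)]]
            hom_flat[OF assms(6)] _ v])
        (use R in \<open>simp add: eqMN \<gamma>gen\<close>)
    show ?L
    proof
      fix q assume q: "q \<in> carrier ((N \<flat> M) \<amalg> (M \<flat> N))"
      have "(\<gamma> \<circ> ?f) q = (\<gamma> \<circ> ?g) q"
        by (rule coprod_hom_eqI[OF F assms(5) \<gamma>f \<gamma>g _ _ q])
          (use 1 2 in \<open>simp_all add: f1 f2 g1 g2\<close>)
      then show "\<gamma> (?f q) = \<gamma> (?g q)" by simp
    qed
  qed
qed

theorem corollary3p12:
  fixes M :: "('m, 'c) monoid_scheme" and N :: "('n, 'd) monoid_scheme"
    and \<alpha> :: "'m \<Rightarrow> 'n \<Rightarrow> 'n" and \<beta> :: "'n \<Rightarrow> 'm \<Rightarrow> 'm"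
    and \<xi>MN :: "('m + 'n) list set \<Rightarrow> 'n" and \<xi>NM :: "('n + 'm) list set \<Rightarrow> 'm"
  assumes "group M" and "group N"
    and "\<alpha> \<in> hom M (AutoGroup N)" and "\<beta> \<in> hom N (AutoGroup M)"
    and "internal_action_of M N \<alpha> \<xi>MN" and "internal_action_of N M \<beta> \<xi>NM"
  shows "internally_compatible M N \<xi>MN \<xi>NM \<longleftrightarrow> classically_compatible M N \<alpha> \<beta>"
proof -
  note MN = assms(1,2) and NM = assms(2,1)
  note P = group_coprod[OF MN]
  note AutM = group.AutoGroup[OF assms(1)] and AutN = group.AutoGroup[OF assms(2)]
  note cM = conjugation_hom[OF assms(1)] and cN = conjugation_hom[OF assms(2)]
  note chiM = internal_action_of_conj_action[OF assms(1)]
    and chiN = internal_action_of_conj_action[OF assms(2)]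
  \<comment> \<open>These are the classical induced actions. The internal actions with these
    underlying group actions are the only candidates in one direction and the witnesses in the
    other.\<close>
  define \<gamma>M where "\<gamma>M = copair (AutoGroup M) (conjugation M) \<beta>"
  define \<gamma>N where "\<gamma>N = copair (AutoGroup N) \<alpha> (conjugation N)"
  note CM = MN AutM cM assms(4) and CN = MN AutN assms(3) cN
  have \<gamma>M: "\<gamma>M \<in> hom (M \<amalg> N) (AutoGroup M)" and \<gamma>N: "\<gamma>N \<in> hom (M \<amalg> N) (AutoGroup N)"
    unfolding \<gamma>M_def \<gamma>N_def by (rule copair_hom[OF CM], rule copair_hom[OF CN])
  have \<gamma>M_incl: "m \<in> carrier M \<Longrightarrow> \<gamma>M (incl1 M N m) = conjugation M m"
    "n \<in> carrier N \<Longrightarrow> \<gamma>M (incl2 M N n) = \<beta> n" for m n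
    unfolding \<gamma>M_def by (rule copair_incl1[OF CM], assumption, rule copair_incl2[OF CM])
  have \<gamma>N_incl: "m \<in> carrier M \<Longrightarrow> \<gamma>N (incl1 M N m) = \<alpha> m"
    "n \<in> carrier N \<Longrightarrow> \<gamma>N (incl2 M N n) = conjugation N n" for m n
    unfolding \<gamma>N_def by (rule copair_incl1[OF CN], assumption, rule copair_incl2[OF CN])
  note \<alpha>c = hom_in_carrier[OF AutoGroup_hom[OF hom_in_carrier[OF assms(3)]]]
    and \<beta>c = hom_in_carrier[OF AutoGroup_hom[OF hom_in_carrier[OF assms(4)]]]

  \<comment> \<open>The folding lemma for \<open>\<xi>NM\<close> expects the factors in the order
    \<open>N\<close>, \<open>M\<close>; the swap plays the role of \<open>s\<close> there, and
    \<open>fold_outer\<close> is the copair of this swap with \<open>incl2\<close>.\<close>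
  have \<gamma>M_swap: "\<gamma>M p = copair (AutoGroup M) \<beta> (conjugation M) (coprod_swap M N p)"
    if p: "p \<in> carrier (M \<amalg> N)" for p
  proof -
    note C = NM AutM assms(4) cM
    have "\<gamma>M p = (copair (AutoGroup M) \<beta> (conjugation M) \<circ> coprod_swap M N) p"
      by (rule coprod_hom_eqI[OF MN AutM \<gamma>M hom_compose[OF coprod_swap_hom[OF MN] copair_hom[OF C]] _ _ p])
        (simp_all add: \<gamma>M_incl coprod_swap_def copair_incl1[OF MN group_coprod[OF NM] incl2_hom incl1_hom]
          copair_incl2[OF MN group_coprod[OF NM] incl2_hom incl1_hom] copair_incl1[OF C] copair_incl2[OF C])
    then show ?thesis by simp
  qed
  have foldM: "\<zeta>M z = \<xi>NM (fold_outer N M z)"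
    if "internal_action_of (M \<amalg> N) M \<gamma>M \<zeta>M" "z \<in> carrier (cosmash3 M N M)" for \<zeta>M z
    using internal_action_of_fold[OF NM assms(4,6) P coprod_swap_hom[OF MN] that(1) \<gamma>M_swap
        cosmash3_flat[OF MN assms(1) that(2)]]
    by (simp add: fold_outer_def cotriple_def coprod_swap_def)

  \<comment> \<open>Here \<open>s\<close> is the identity, in the form in which it occurs inside
    \<open>fold_right\<close>.\<close>
  have incls: "copair (M \<amalg> N) (incl1 M N) (incl2 M N) p = p" if "p \<in> carrier (M \<amalg> N)" for p
    by (rule coprod_hom_eqI[OF MN P copair_hom[OF MN P incl1_hom incl2_hom] id_hom _ _ that])
      (simp_all add: copair_incl1[OF MN P incl1_hom incl2_hom] copair_incl2[OF MN P incl1_hom incl2_hom])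
  have foldN: "\<zeta>N z = \<xi>MN (fold_right M N z)"
    if "internal_action_of (M \<amalg> N) N \<gamma>N \<zeta>N" "z \<in> carrier (cosmash3 M N N)" for \<zeta>N z
    using internal_action_of_fold[OF MN assms(3,5) P copair_hom[OF MN P incl1_hom incl2_hom] that(1) _
        cosmash3_flat[OF MN assms(2) that(2)]]
    by (simp add: fold_right_def cotriple_def incls \<gamma>N_def)

  \<comment> \<open>\<open>KM m n\<close> and \<open>KN n m\<close> are the automorphisms by which
    the words \<open>m n m^-1\<close> and \<open>n m n^-1\<close> act on \<open>M\<close> and on
    \<open>N\<close>. \<open>compM\<close> is the condition \<open>?R2\<close> above for
    \<open>\<gamma>M\<close>, and \<open>compN\<close> is \<open>?R1\<close> for
    \<open>\<gamma>N\<close>.\<close>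
  define KM where "KM m n = \<gamma>M (incl1 M N m) \<otimes>\<^bsub>AutoGroup M\<^esub> \<gamma>M (incl2 M N n)
    \<otimes>\<^bsub>AutoGroup M\<^esub> inv\<^bsub>AutoGroup M\<^esub> (\<gamma>M (incl1 M N m))" for m n
  define KN where "KN n m = \<gamma>N (incl2 M N n) \<otimes>\<^bsub>AutoGroup N\<^esub> \<gamma>N (incl1 M N m)
    \<otimes>\<^bsub>AutoGroup N\<^esub> inv\<^bsub>AutoGroup N\<^esub> (\<gamma>N (incl2 M N n))" for n m
  define compM where "compM \<longleftrightarrow> (\<forall>m \<in> carrier M. \<forall>n \<in> carrier N. \<gamma>M (incl2 M N (\<alpha> m n)) = KM m n)"
  define compN where "compN \<longleftrightarrow> (\<forall>n \<in> carrier N. \<forall>m \<in> carrier M. \<gamma>N (incl1 M N (\<beta> n m)) = KN n m)"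

  have classical: "classically_compatible M N \<alpha> \<beta> \<longleftrightarrow> compM \<and> compN"
  proof -
    interpret P: group "M \<amalg> N" by (rule P)
    have M1: "\<gamma>M (incl1 M N m \<otimes>\<^bsub>M \<amalg> N\<^esub> incl2 M N n \<otimes>\<^bsub>M \<amalg> N\<^esub> incl1 M N (inv\<^bsub>M\<^esub> m)) = KM m n"
      if "m \<in> carrier M" "n \<in> carrier N" for m n
      using hom_coprod_conj[OF MN AutM \<gamma>M that(1) incl2_closed[OF that(2)]]
      by (simp add: coprod_conj_def KM_def)
    have N1: "\<gamma>N (incl2 M N n \<otimes>\<^bsub>M \<amalg> N\<^esub> incl1 M N m \<otimes>\<^bsub>M \<amalg> N\<^esub> incl2 M N (inv\<^bsub>N\<^esub> n)) = KN n m"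
      if "m \<in> carrier M" "n \<in> carrier N" for m n
      using that by (simp add: hom_mult[OF \<gamma>N] incl1_closed incl2_closed KN_def
          hom_inv_eq[OF assms(2) P incl2_hom] hom_inv_eq[OF P AutN \<gamma>N])
    \<comment> \<open>The left side is the automorphism \<open>\<beta> (\<alpha> m n)\<close>;
      comparing the two automorphisms on the carrier brings in the classical variable
      \<open>m'\<close>.\<close>
    have "\<gamma>M (incl2 M N (\<alpha> m n)) = KM m n \<longleftrightarrow> (\<forall>m' \<in> carrier M. \<beta> (\<alpha> m n) m' = KM m n m')"
      if mn: "m \<in> carrier M" "n \<in> carrier N" for m n
    proof -
      have "KM m n \<in> carrier (AutoGroup M)"
        using mn by (simp flip: M1 add: hom_in_carrier[OF \<gamma>M] incl1_closed incl2_closed group.inv_closed[OF assms(1)])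
      then show ?thesis
        using AutoGroup_eq_iff[OF hom_in_carrier[OF \<gamma>M incl2_closed[OF \<alpha>c[OF mn]]]] mn
        by (simp add: \<gamma>M_incl \<alpha>c)
    qed
    moreover have "\<gamma>N (incl1 M N (\<beta> n m)) = KN n m \<longleftrightarrow> (\<forall>n' \<in> carrier N. \<alpha> (\<beta> n m) n' = KN n m n')"
      if nm: "n \<in> carrier N" "m \<in> carrier M" for m n
    proof -
      have "KN n m \<in> carrier (AutoGroup N)"
        using nm by (simp flip: N1 add: hom_in_carrier[OF \<gamma>N] incl1_closed incl2_closed group.inv_closed[OF assms(2)])
      then show ?thesis
        using AutoGroup_eq_iff[OF hom_in_carrier[OF \<gamma>N incl1_closed[OF \<beta>c[OF nm]]]] nm
        by (simp add: \<gamma>N_incl \<beta>c)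
    qed
    ultimately have "compM \<longleftrightarrow> (\<forall>m\<in>carrier M. \<forall>n\<in>carrier N. \<forall>m'\<in>carrier M. \<beta> (\<alpha> m n) m' = KM m n m')"
      and "compN \<longleftrightarrow> (\<forall>n\<in>carrier N. \<forall>m\<in>carrier M. \<forall>n'\<in>carrier N. \<alpha> (\<beta> n m) n' = KN n m n')"
      by (simp_all add: compM_def compN_def)
    moreover have "classically_compatible M N \<alpha> \<beta> \<longleftrightarrow>
        (\<forall>m\<in>carrier M. \<forall>m'\<in>carrier M. \<forall>n\<in>carrier N. \<beta> (\<alpha> m n) m' = KM m n m') \<and>
        (\<forall>m\<in>carrier M. \<forall>n\<in>carrier N. \<forall>n'\<in>carrier N. \<alpha> (\<beta> n m) n' = KN n m n')"
      unfolding classically_compatible_def by (simp add: M1 N1 flip: \<gamma>M_def \<gamma>N_def)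
    ultimately show ?thesis by blast
  qed

  let ?f = "coprod_map M N \<xi>NM \<xi>MN" and ?g = "copair (M \<amalg> N) (coprod_swap N M) (\<lambda>y. y)"
  let ?Q = "(N \<flat> M) \<amalg> (M \<flat> N)"
  note F = group_flat[OF NM] group_flat[OF MN]
  note Q = group_coprod[OF F]
  have f: "?f \<in> hom ?Q (M \<amalg> N)"
    by (rule coprod_map_hom[OF F MN internal_action_of_hom[OF assms(6)] internal_action_of_hom[OF assms(5)]])
  have g: "?g \<in> hom ?Q (M \<amalg> N)"
    by (rule copair_hom[OF F P hom_flat[OF coprod_swap_hom[OF NM]] flat_incl_hom])

  have CA_M: "(\<forall>x \<in> carrier (?Q \<flat> M).
        \<zeta>M (coprod_map (M \<amalg> N) M ?f (\<lambda>m. m) x) = \<zeta>M (coprod_map (M \<amalg> N) M ?g (\<lambda>m. m) x)) \<longleftrightarrow> compM"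
    if \<zeta>M: "internal_action_of (M \<amalg> N) M \<gamma>M \<zeta>M" for \<zeta>M
  proof -
    \<comment> \<open>The half of (CA.M) on the generators \<open>n m n^-1\<close>: both sides are
      conjugation by \<open>\<beta> n m\<close>, because \<open>\<beta> n\<close> is an
      automorphism. What remains is \<open>compM\<close>.\<close>
    have "\<gamma>M (incl1 M N (\<beta> n m)) = \<gamma>M (incl2 M N n) \<otimes>\<^bsub>AutoGroup M\<^esub> \<gamma>M (incl1 M N m)
        \<otimes>\<^bsub>AutoGroup M\<^esub> inv\<^bsub>AutoGroup M\<^esub> (\<gamma>M (incl2 M N n))"
      if "n \<in> carrier N" "m \<in> carrier M" for n m
      using that by (simp add: \<gamma>M_incl \<beta>c AutoGroup_conj_conjugation assms(1) hom_in_carrier[OF assms(4)])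
    then show ?thesis
      unfolding pullback_eq_iff[OF Q P assms(1) \<zeta>M \<gamma>M f g]
        hom_coprod_map_eq_copair_swap_iff[OF MN assms(5,6) AutM \<gamma>M]
      by (simp add: compM_def KM_def)
  qed
  have CA_N: "(\<forall>x \<in> carrier (?Q \<flat> N).
        \<zeta>N (coprod_map (M \<amalg> N) N ?f (\<lambda>n. n) x) = \<zeta>N (coprod_map (M \<amalg> N) N ?g (\<lambda>n. n) x)) \<longleftrightarrow> compN"
    if \<zeta>N: "internal_action_of (M \<amalg> N) N \<gamma>N \<zeta>N" for \<zeta>N
  proof -
    \<comment> \<open>Symmetrically, on \<open>m n m^-1\<close> both sides are conjugation by
      \<open>\<alpha> m n\<close>, which leaves \<open>compN\<close>.\<close>
    have "\<gamma>N (incl2 M N (\<alpha> m n)) = \<gamma>N (incl1 M N m) \<otimes>\<^bsub>AutoGroup N\<^esub> \<gamma>N (incl2 M N n)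
        \<otimes>\<^bsub>AutoGroup N\<^esub> inv\<^bsub>AutoGroup N\<^esub> (\<gamma>N (incl1 M N m))"
      if "m \<in> carrier M" "n \<in> carrier N" for m n
      using that by (simp add: \<gamma>N_incl \<alpha>c AutoGroup_conj_conjugation assms(2) hom_in_carrier[OF assms(3)])
    then show ?thesis
      unfolding pullback_eq_iff[OF Q P assms(2) \<zeta>N \<gamma>N f g]
        hom_coprod_map_eq_copair_swap_iff[OF MN assms(5,6) AutN \<gamma>N]
      by (simp add: compN_def KN_def)
  qed

  note pbM = copair_pullback[OF MN assms(1) cM assms(4), folded \<gamma>M_def]
    and pbN = copair_pullback[OF MN assms(2,3) cN, folded \<gamma>N_def]
  show ?thesis
  proof
    assume "internally_compatible M N \<xi>MN \<xi>NM"
    then obtain \<zeta>M \<zeta>N where \<zeta>: "internal_action (M \<amalg> N) M \<zeta>M" "internal_action (M \<amalg> N) N \<zeta>N"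
      and CA0_M: "\<forall>x \<in> carrier (N \<flat> M). \<zeta>M (coprod_map (M \<amalg> N) M (incl2 M N) (\<lambda>m. m) x) = \<xi>NM x"
        "\<forall>x \<in> carrier (M \<flat> M). \<zeta>M (coprod_map (M \<amalg> N) M (incl1 M N) (\<lambda>m. m) x) = conj_action M x"
      and CA0_N: "\<forall>x \<in> carrier (M \<flat> N). \<zeta>N (coprod_map (M \<amalg> N) N (incl1 M N) (\<lambda>n. n) x) = \<xi>MN x"
        "\<forall>x \<in> carrier (N \<flat> N). \<zeta>N (coprod_map (M \<amalg> N) N (incl2 M N) (\<lambda>n. n) x) = conj_action N x"
      and CA: "\<forall>x \<in> carrier (?Q \<flat> M).
          \<zeta>M (coprod_map (M \<amalg> N) M ?f (\<lambda>m. m) x) = \<zeta>M (coprod_map (M \<amalg> N) M ?g (\<lambda>m. m) x)"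
        "\<forall>x \<in> carrier (?Q \<flat> N).
          \<zeta>N (coprod_map (M \<amalg> N) N ?f (\<lambda>n. n) x) = \<zeta>N (coprod_map (M \<amalg> N) N ?g (\<lambda>n. n) x)"
      unfolding internally_compatible_def by (elim exE conjE) (rule that)
    \<comment> \<open>The equation for the first factor \<open>M\<close> comes first. On
      \<open>M\<close> that is the one with \<open>conj_action\<close>, hence the order
      \<open>CA0_M(2,1)\<close>.\<close>
    have "internal_action_of (M \<amalg> N) M \<gamma>M \<zeta>M" "internal_action_of (M \<amalg> N) N \<gamma>N \<zeta>N"
      unfolding \<gamma>M_def \<gamma>N_def
      by (rule internal_action_of_copair[OF MN assms(1) cM assms(4) \<zeta>(1) chiM assms(6) CA0_M(2,1)])
        (rule internal_action_of_copair[OF MN assms(2,3) cN \<zeta>(2) assms(5) chiN CA0_N])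
    then show "classically_compatible M N \<alpha> \<beta>"
      unfolding classical using CA_M CA_N CA by blast
  next
    assume "classically_compatible M N \<alpha> \<beta>"
    then have comp: compM compN unfolding classical by simp_all
    obtain \<zeta>M where \<zeta>M: "internal_action_of (M \<amalg> N) M \<gamma>M \<zeta>M"
      using ex_internal_action_of[OF P assms(1) \<gamma>M] by blast
    obtain \<zeta>N where \<zeta>N: "internal_action_of (M \<amalg> N) N \<gamma>N \<zeta>N"
      using ex_internal_action_of[OF P assms(2) \<gamma>N] by blast
    show "internally_compatible M N \<xi>MN \<xi>NM"
      unfolding internally_compatible_def
    proof (intro exI[of _ \<zeta>M] exI[of _ \<zeta>N] conjI)
      show "internal_action (M \<amalg> N) M \<zeta>M" "internal_action (M \<amalg> N) N \<zeta>N"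
        using \<zeta>M \<zeta>N by (simp_all add: internal_action_of_def)
    qed (use foldM[OF \<zeta>M] foldN[OF \<zeta>N] pbM(1)[OF \<zeta>M chiM] pbM(2)[OF \<zeta>M assms(6)]
        pbN(1)[OF \<zeta>N assms(5)] pbN(2)[OF \<zeta>N chiN] comp CA_M[OF \<zeta>M] CA_N[OF \<zeta>N] in blast)+
  qed
qed

end
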